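(* Let $H$ be an $n$-qubit Hamiltonian with unknown spectral decomposition $H=\sum_{j=0}^{N-1} E_j |E_j\rangle\langle E_j|$, where $N=2^n$, the $|E_j\rangle$ are orthonormal, and $0\le E_0<E_1\le E_2\le\dots\le E_{N-1}\le\pi$; let $\Delta_{\rm true}:=E_1-E_0$. Suppose we can prepare an $n$-qubit state $|\psi\rangle=\sum_j\gamma_j|E_j\rangle$ with $|\gamma_0|^2\ge\eta$, where $\eta\in(0,1)$ is known, and let $\epsilon>0$ and $\delta\in(0,1)$ be given. There exists an algorithm that, given arbitrary $\sigma>0$ and $\hat E_0\in[E_0-\sigma,E_0+\sigma]$ (but no bound on the spectral gap $\Delta_{\rm true}$), uses $$\tilde{\mathcal O}\left(\eta^{-3}\epsilon^{-4}\log(\delta^{-1})\right)$$ block-encodings of Gaussian functions of $H$ in expectation, and generates a new estimate $\hat E_0'$ of $E_0$, which it either accepts or rejects. If $|\hat E_0'-E_0|\ge\epsilon$, it rejects $\hat E_0'$ with probability at least $1-\delta$. If it accepts, then $|\hat E_0'-E_0|\le\epsilon$, with probability of incorrect acceptance at most $\delta$. Furthermore, there exists some $$\sigma_0=\Omega\left(\frac{\Delta_{\rm true}}{\log(\epsilon^{-1}\eta^{-1})}\right)$$ such that if $\sigma\le\sigma_0$, then this algorithm outputs an estimate $\hat E_0'$ that it accepts with probability $1-\delta$ and is such that $|\hat E_0'-E_0|\le\epsilon$.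
   Context: An $(n+m)$-qubit unitary $U$ is an $(\alpha,m,\epsilon')$-block-encoding of an $n$-qubit operator $A$ if $\|A-\alpha(\langle 0^m|\otimes I)U(|0^m\rangle\otimes I)\|\le\epsilon'$. A "block-encoding of a Gaussian function of $H$" means a $(1,1,\epsilon')$-block-encoding of $e^{-(H-\xi I)^2/(2s^2)}$ with a real shift $\xi$, width $s=\Theta(\sigma)$ and precision $\epsilon'\in(0,1)$; it is implemented using controlled evolutions $|0\rangle\langle0|\otimes I+|1\rangle\langle1|\otimes e^{iHt}$ of total time $\mathcal O(s^{-1}\sqrt{\log(1/\epsilon')})$ and $\mathcal O(s^{-1}T\sqrt{\log(1/\epsilon')})$ primitive gates with $T=\max(2\pi,\Theta(s\sqrt{\log(1/\epsilon')}))$. (This construction is for Hamiltonians of norm at most $\pi/2$ and $\xi\in[-\pi/2,\pi/2]$, which is arranged by shifting $H$ by a multiple of the identity.) The algorithm accesses $H$ only through such operations and $|\psi\rangle$ only through preparing copies of it. $\tilde{\mathcal O}$ hides factors polylogarithmic in $\eta^{-1},\epsilon^{-1},\delta^{-1},\sigma^{-1}$; constants are absolute. *)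

theory Defs
  imports
    "HOL-Analysis.Infinite_Sum"
    "HOL-Library.Extended_Nonnegative_Real"
    "Jordan_Normal_Form.Schur_Decomposition"
begin

section \<open>Finite-dimensional linear algebra\<close>

definition vec_norm :: "complex vec \<Rightarrow> real" where
  "vec_norm v = sqrt (\<Sum>i<dim_vec v. (cmod (v $ i))\<^sup>2)"

definition op_norm :: "complex mat \<Rightarrow> real" where
  "op_norm A = (SUP v\<in>{v \<in> carrier_vec (dim_col A). vec_norm v = 1}. vec_norm (A *\<^sub>v v))"

definition unitary_mat :: "nat \<Rightarrow> complex mat \<Rightarrow> bool" where
  "unitary_mat d U \<longleftrightarrow> U \<in> carrier_mat d d \<and> mat_adjoint U * U = 1\<^sub>m d \<and> U * mat_adjoint U = 1\<^sub>m d"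

text \<open>In both Kronecker products the left factor is the most significant one.\<close>

definition kron_mat :: "complex mat \<Rightarrow> complex mat \<Rightarrow> complex mat" where
  "kron_mat A B = mat (dim_row A * dim_row B) (dim_col A * dim_col B)
     (\<lambda>(i, j). A $$ (i div dim_row B, j div dim_col B) * B $$ (i mod dim_row B, j mod dim_col B))"

definition kron_vec :: "complex vec \<Rightarrow> complex vec \<Rightarrow> complex vec" where
  "kron_vec v w = vec (dim_vec v * dim_vec w) (\<lambda>i. v $ (i div dim_vec w) * w $ (i mod dim_vec w))"

text \<open>The exponential power series, summed entrywise.\<close>

definition mat_exp :: "complex mat \<Rightarrow> complex mat" where
  "mat_exp A = mat (dim_row A) (dim_row A) (\<lambda>(i, j). \<Sum>k. (A ^\<^sub>m k) $$ (i, j) / fact k)"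

definition spectral_decomposition ::
  "nat \<Rightarrow> complex mat \<Rightarrow> (nat \<Rightarrow> real) \<Rightarrow> (nat \<Rightarrow> complex vec) \<Rightarrow> bool" where
  "spectral_decomposition N H E e \<longleftrightarrow>
     (\<forall>j<N. e j \<in> carrier_vec N) \<and>
     (\<forall>i<N. \<forall>j<N. e i \<bullet>c e j = (if i = j then 1 else 0)) \<and>
     H = mat N N (\<lambda>(a, b). \<Sum>j<N. complex_of_real (E j) * (e j $ a) * cnj (e j $ b))"

section \<open>Block-encodings of Gaussian functions\<close>

definition ket_zeros :: "nat \<Rightarrow> complex mat" where
  "ket_zeros m = mat (2 ^ m) 1 (\<lambda>(i, j). if i = 0 then 1 else 0)"

definition block_encoding ::
  "nat \<Rightarrow> complex mat \<Rightarrow> real \<Rightarrow> nat \<Rightarrow> real \<Rightarrow> complex mat \<Rightarrow> bool" where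
  "block_encoding n A \<alpha> m \<epsilon>' U \<longleftrightarrow>
     A \<in> carrier_mat (2 ^ n) (2 ^ n) \<and> unitary_mat (2 ^ (n + m)) U \<and>
     op_norm (A - complex_of_real \<alpha> \<cdot>\<^sub>m
       (kron_mat (mat_adjoint (ket_zeros m)) (1\<^sub>m (2 ^ n)) * U * kron_mat (ket_zeros m) (1\<^sub>m (2 ^ n)))) \<le> \<epsilon>'"

definition gaussian_of :: "nat \<Rightarrow> complex mat \<Rightarrow> real \<Rightarrow> real \<Rightarrow> complex mat" where
  "gaussian_of n H \<xi> s =
     mat_exp (complex_of_real (- 1 / (2 * s\<^sup>2)) \<cdot>\<^sub>m ((H - complex_of_real \<xi> \<cdot>\<^sub>m 1\<^sub>m (2 ^ n)) ^\<^sub>m 2))"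

text \<open>
  An oracle supplies, for a shift \<open>\<xi>\<close>, a width \<open>s\<close> and a precision \<open>\<epsilon>'\<close>, some unitary that
  block-encodes the Gaussian; which block-encoding it is remains arbitrary.  The shifts
  \<open>0 \<le> \<xi> \<le> pi\<close> are those for which \<open>\<bar>\<xi> - pi / 2\<bar> \<le> pi / 2\<close>, i.e. the admissible ones once \<open>H\<close>, with
  spectrum in the interval from \<open>0\<close> to \<open>pi\<close>, is replaced by \<open>H - (pi / 2) I\<close> of norm at most \<open>pi / 2\<close>.
\<close>

definition gaussian_oracle ::
  "nat \<Rightarrow> complex mat \<Rightarrow> (real \<Rightarrow> real \<Rightarrow> real \<Rightarrow> complex mat) \<Rightarrow> bool" where
  "gaussian_oracle n H B \<longleftrightarrow>
     (\<forall>\<xi> s \<epsilon>'. 0 \<le> \<xi> \<and> \<xi> \<le> pi \<and> 0 < s \<and> 0 < \<epsilon>' \<and> \<epsilon>' < 1 \<longrightarrow>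
        block_encoding n (gaussian_of n H \<xi> s) 1 1 \<epsilon>' (B \<xi> s \<epsilon>'))"

section \<open>Quantum algorithms with access to the oracle and to copies of the state\<close>

text \<open>
  An algorithm is an adaptive strategy: it maps the list of classical outcomes seen so far (most
  recent first) to its next action.
  \<^item> \<open>Halt x a\<close> stops with the estimate \<open>x\<close>, accepted iff \<open>a\<close> holds.
  \<^item> \<open>Prepare\<close> appends a fresh copy of \<open>\<psi>\<close> to the workspace.
  \<^item> \<open>Instrument q Ks\<close> is a quantum operation, independent of \<open>H\<close> and \<open>\<psi>\<close>, that leaves \<open>q\<close> qubits:
    outcome \<open>k\<close> has the single Kraus operator \<open>Ks ! k\<close>.  This covers unitary gates, adding
    ancillas, measurements, discarding qubits (measure and ignore the outcome) and coin tosses.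
  \<^item> \<open>Query \<xi> s \<epsilon>'\<close> applies the oracle's block-encoding to the last \<open>n + 1\<close> qubits, the
    block-encoding ancilla being the first of these.
\<close>

datatype action =
    Halt real bool
  | Prepare
  | Instrument nat "complex mat list"
  | Query real real real

type_synonym algorithm = "nat list \<Rightarrow> action"

text \<open>Histories that are consistent with the strategy; deterministic actions have outcome \<open>0\<close>.\<close>

fun reachable :: "algorithm \<Rightarrow> nat list \<Rightarrow> bool" where
  "reachable A [] \<longleftrightarrow> True"
| "reachable A (k # h) \<longleftrightarrow> reachable A h \<and>
     (case A h of
        Halt x a \<Rightarrow> False
      | Prepare \<Rightarrow> k = 0
      | Instrument q Ks \<Rightarrow> k < length Ks
      | Query \<xi> s \<epsilon>' \<Rightarrow> k = 0)"

fun num_qubits :: "nat \<Rightarrow> algorithm \<Rightarrow> nat list \<Rightarrow> nat" where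
  "num_qubits n A [] = 0"
| "num_qubits n A (k # h) =
     (case A h of
        Halt x a \<Rightarrow> num_qubits n A h
      | Prepare \<Rightarrow> num_qubits n A h + n
      | Instrument q Ks \<Rightarrow> q
      | Query \<xi> s \<epsilon>' \<Rightarrow> num_qubits n A h)"

definition kraus_complete :: "nat \<Rightarrow> complex mat list \<Rightarrow> bool" where
  "kraus_complete d Ks \<longleftrightarrow> foldr (+) (map (\<lambda>K. mat_adjoint K * K) Ks) (0\<^sub>m d d) = 1\<^sub>m d"

text \<open>The bounds \<open>s_lo\<close> and \<open>s_hi\<close> delimit the Gaussian widths that may be queried.\<close>

definition valid_algorithm :: "nat \<Rightarrow> real \<Rightarrow> real \<Rightarrow> algorithm \<Rightarrow> bool" where
  "valid_algorithm n s_lo s_hi A \<longleftrightarrow>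
     (\<forall>h. reachable A h \<longrightarrow>
        (case A h of
           Halt x a \<Rightarrow> True
         | Prepare \<Rightarrow> True
         | Instrument q Ks \<Rightarrow>
             set Ks \<subseteq> carrier_mat (2 ^ q) (2 ^ num_qubits n A h) \<and>
             kraus_complete (2 ^ num_qubits n A h) Ks
         | Query \<xi> s \<epsilon>' \<Rightarrow>
             n + 1 \<le> num_qubits n A h \<and> 0 \<le> \<xi> \<and> \<xi> \<le> pi \<and> s_lo \<le> s \<and> s \<le> s_hi \<and> 0 < \<epsilon>' \<and> \<epsilon>' < 1))"

text \<open>
  The unnormalised workspace state after a reachable history: its squared norm is the probability
  of that history.  It stays pure because each outcome has a single Kraus operator.  The initial
  workspace has no qubits.
\<close>

fun run_state ::
  "nat \<Rightarrow> complex vec \<Rightarrow> (real \<Rightarrow> real \<Rightarrow> real \<Rightarrow> complex mat) \<Rightarrow> algorithm \<Rightarrow> nat list \<Rightarrow> complex vec" where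
  "run_state n \<psi> B A [] = vec 1 (\<lambda>_. 1)"
| "run_state n \<psi> B A (k # h) =
     (case A h of
        Halt x a \<Rightarrow> run_state n \<psi> B A h
      | Prepare \<Rightarrow> kron_vec (run_state n \<psi> B A h) \<psi>
      | Instrument q Ks \<Rightarrow> (Ks ! k) *\<^sub>v run_state n \<psi> B A h
      | Query \<xi> s \<epsilon>' \<Rightarrow>
          kron_mat (1\<^sub>m (2 ^ (num_qubits n A h - (n + 1)))) (B \<xi> s \<epsilon>') *\<^sub>v run_state n \<psi> B A h)"

definition history_prob ::
  "nat \<Rightarrow> complex vec \<Rightarrow> (real \<Rightarrow> real \<Rightarrow> real \<Rightarrow> complex mat) \<Rightarrow> algorithm \<Rightarrow> nat list \<Rightarrow> ennreal" where
  "history_prob n \<psi> B A h = ennreal ((vec_norm (run_state n \<psi> B A h))\<^sup>2)"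

definition output_prob ::
  "nat \<Rightarrow> complex vec \<Rightarrow> (real \<Rightarrow> real \<Rightarrow> real \<Rightarrow> complex mat) \<Rightarrow> algorithm \<Rightarrow> (real \<Rightarrow> bool \<Rightarrow> bool) \<Rightarrow> ennreal"
where
  "output_prob n \<psi> B A P =
     infsum (history_prob n \<psi> B A) {h. reachable A h \<and> (\<exists>x a. A h = Halt x a \<and> P x a)}"

text \<open>Every history ending in a query contributes its probability of being reached.\<close>

definition expected_queries ::
  "nat \<Rightarrow> complex vec \<Rightarrow> (real \<Rightarrow> real \<Rightarrow> real \<Rightarrow> complex mat) \<Rightarrow> algorithm \<Rightarrow> ennreal" where
  "expected_queries n \<psi> B A =
     infsum (history_prob n \<psi> B A) {h. reachable A h \<and> (\<exists>\<xi> s \<epsilon>'. A h = Query \<xi> s \<epsilon>')}"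

section \<open>Asymptotic notation\<close>

text \<open>
  Logarithms hidden in asymptotic notation are truncated from below at \<open>1\<close>, so that bounds valid
  for large arguments also make sense for arguments near or below \<open>1\<close>.
\<close>

definition log_trunc :: "real \<Rightarrow> real" where
  "log_trunc x = max 1 (ln x)"

end

theory Submission
  imports Defs "HOL-Analysis.L2_Norm"
begin

text \<open>
  The success probability of a block-encoded Gaussian of width \<open>\<sigma>\<close> and shift \<open>\<xi>\<close> is the average of
  \<open>exp (- ((E - \<xi>) / \<sigma>)\<^sup>2)\<close> over the spectral measure of \<open>\<psi>\<close>.  Estimating it for three shifts in
  arithmetic progression around \<open>Ehat\<close> determines, for every \<open>y\<close>, the second moment about \<open>y\<close> of
  \<open>exp (\<plusminus> 2 * (E - \<xi>) / \<sigma>)\<close> under the Gaussian-filtered measure.  The ground state has filtered weight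
  at least \<open>\<eta> * exp (- 1)\<close>, so a second moment of order \<open>\<eta> * \<epsilon>\<^sup>2\<close> about some \<open>y\<close> certifies that \<open>y\<close>
  encodes \<open>E 0\<close> up to \<open>\<epsilon>\<close>, whatever the gap is.  Conversely, if \<open>\<sigma>\<close> is small compared with the
  gap, the filter suppresses all other eigenvalues and such a \<open>y\<close> exists.
  Sampling to additive precision of order \<open>\<eta> * \<epsilon>\<^sup>2\<close> takes of the order of \<open>1 / (\<eta>\<^sup>2 * \<epsilon> ^ 4)\<close> rounds.

  With probability \<open>\<delta>\<^sup>2\<close> the algorithm rejects at once with a far-off estimate.  Thus the event of a
  bad estimate is never so rare that the conditional rejection probability gets out of control, and the
  expected cost carries the factor \<open>1 - \<delta>\<^sup>2 \<le> 2 * ln (1 / \<delta>)\<close>, which is needed for \<open>\<delta>\<close> near \<open>1\<close>.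
\<close>

section \<open>Spectral calculus and norms\<close>

lemma dim_mat_adjoint [simp]:
  "dim_row (mat_adjoint A) = dim_col A" "dim_col (mat_adjoint A) = dim_row A"
  by (simp_all add: mat_adjoint_def)

lemma index_mat_adjoint:
  fixes A :: "complex mat"
  assumes "i < dim_col A" "j < dim_row A"
  shows "mat_adjoint A $$ (i, j) = cnj (A $$ (j, i))"
  using assms by (simp add: mat_adjoint_def mat_of_rows_index)

lemma index_mult_mat_sum:
  assumes "i < dim_row A" "j < dim_col B" "dim_col A = dim_row B"
  shows "(A * B) $$ (i, j) = (\<Sum>k<dim_row B. A $$ (i, k) * B $$ (k, j))"
  using assms by (simp add: scalar_prod_def atLeast0LessThan)

lemma index_mult_mat_vec_sum:
  assumes "i < dim_row A" "dim_col A = dim_vec v"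
  shows "(A *\<^sub>v v) $ i = (\<Sum>k<dim_vec v. A $$ (i, k) * v $ k)"
  using assms by (simp add: scalar_prod_def atLeast0LessThan)

lemma power2_vec_norm: "(vec_norm v)\<^sup>2 = (\<Sum>i<dim_vec v. (cmod (v $ i))\<^sup>2)"
  by (simp add: vec_norm_def sum_nonneg)

lemma vec_norm_nonneg: "0 \<le> vec_norm v"
  by (simp add: vec_norm_def sum_nonneg)

text \<open>Parseval's identity: expand the squared modulus and exchange the sums. The family
  \<open>f\<close> is a bare function, so that it covers both the columns of a unitary and the
  eigenvectors. The computation runs over the complex numbers and is pulled back to the reals at the
  end.\<close>

lemma sum_cmod_orthonormal:
  fixes f :: "nat \<Rightarrow> nat \<Rightarrow> complex"
  assumes orth: "\<And>i j. i < N \<Longrightarrow> j < N \<Longrightarrow>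
      (\<Sum>a<M. f i a * cnj (f j a)) = (if i = j then 1 else 0)"
  shows "(\<Sum>a<M. (cmod (\<Sum>j<N. c j * f j a))\<^sup>2) = (\<Sum>j<N. (cmod (c j))\<^sup>2)"
proof -
  have "complex_of_real (\<Sum>a<M. (cmod (\<Sum>j<N. c j * f j a))\<^sup>2)
      = (\<Sum>a<M. (\<Sum>i<N. c i * f i a) * cnj (\<Sum>j<N. c j * f j a))"
    by (simp add: complex_norm_square del: of_real_power cnj_sum)
  also have "\<dots> = (\<Sum>a<M. \<Sum>i<N. \<Sum>j<N. c i * cnj (c j) * (f i a * cnj (f j a)))"
    by (simp add: sum_product mult_ac)
  also have "\<dots> = (\<Sum>i<N. \<Sum>j<N. c i * cnj (c j) * (\<Sum>a<M. f i a * cnj (f j a)))"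
    by (simp add: sum_distrib_left sum.swap[of _ "{..<N}" "{..<M}"] cong: sum.cong)
  also have "\<dots> = (\<Sum>i<N. \<Sum>j<N. if i = j then c i * cnj (c j) else 0)"
    by (intro sum.cong refl) (simp add: orth)
  also have "\<dots> = (\<Sum>i<N. c i * cnj (c i))"
    by (simp add: sum.delta)
  also have "\<dots> = complex_of_real (\<Sum>j<N. (cmod (c j))\<^sup>2)"
    by (simp add: complex_norm_square del: of_real_power)
  finally show ?thesis
    using of_real_eq_iff by blast
qed

lemma vec_norm_unitary:
  assumes U: "unitary_mat d U" and v: "v \<in> carrier_vec d"
  shows "vec_norm (U *\<^sub>v v) = vec_norm v"
proof -
  have Uc: "U \<in> carrier_mat d d" and UU: "mat_adjoint U * U = 1\<^sub>m d"
    using U by (auto simp: unitary_mat_def)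
  have orth: "(\<Sum>a<d. U $$ (a, i) * cnj (U $$ (a, j))) = (if i = j then 1 else 0)"
    if "i < d" "j < d" for i j
  proof -
    have "(mat_adjoint U * U) $$ (j, i) = (\<Sum>a<d. cnj (U $$ (a, j)) * U $$ (a, i))"
      using that Uc by (subst index_mult_mat_sum) (auto simp: index_mat_adjoint intro!: sum.cong)
    then show ?thesis
      using that by (auto simp: UU mult.commute)
  qed
  have "(\<Sum>a<d. (cmod ((U *\<^sub>v v) $ a))\<^sup>2) = (\<Sum>a<d. (cmod (\<Sum>j<d. v $ j * U $$ (a, j)))\<^sup>2)"
    using Uc v by (intro sum.cong refl) (subst index_mult_mat_vec_sum, auto simp: mult.commute)
  also have "\<dots> = (\<Sum>j<d. (cmod (v $ j))\<^sup>2)"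
    by (rule sum_cmod_orthonormal) (use orth in auto)
  finally show ?thesis
    using Uc v by (simp add: vec_norm_def)
qed

text \<open>The supremum in \<open>op_norm\<close> is that of a bounded set, so it is not a junk value.\<close>

lemma vec_norm_mult_le_op_norm:
  assumes v: "v \<in> carrier_vec (dim_col A)" and v1: "vec_norm v = 1"
  shows "vec_norm (A *\<^sub>v v) \<le> op_norm A"
proof -
  \<comment> \<open>A crude bound suffices, since only boundedness is at stake: components of a unit
    vector have modulus at most 1, so each component of the image is bounded by an absolute row
    sum.\<close>
  define b where "b = sqrt (\<Sum>i<dim_row A. (\<Sum>k<dim_col A. cmod (A $$ (i, k)))\<^sup>2)"
  have bound: "vec_norm (A *\<^sub>v w) \<le> b" if w: "w \<in> carrier_vec (dim_col A)" "vec_norm w = 1" for w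
  proof -
    have w1: "cmod (w $ k) \<le> 1" if "k < dim_col A" for k
    proof -
      have "(cmod (w $ k))\<^sup>2 \<le> (\<Sum>i<dim_vec w. (cmod (w $ i))\<^sup>2)"
        using that w by (intro member_le_sum) auto
      also have "\<dots> = 1\<^sup>2"
        using w by (simp only: power2_vec_norm[symmetric])
      finally show ?thesis
        by (rule power2_le_imp_le) simp
    qed
    have "cmod ((A *\<^sub>v w) $ i) \<le> (\<Sum>k<dim_col A. cmod (A $$ (i, k)))" if "i < dim_row A" for i
    proof -
      have "cmod ((A *\<^sub>v w) $ i) \<le> (\<Sum>k<dim_col A. cmod (A $$ (i, k) * w $ k))"
        using that w by (subst index_mult_mat_vec_sum) (auto intro!: sum_norm_le)
      also have "\<dots> \<le> (\<Sum>k<dim_col A. cmod (A $$ (i, k)))"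
        using w1 by (intro sum_mono) (simp add: norm_mult mult_left_le)
      finally show ?thesis .
    qed
    then show ?thesis
      unfolding vec_norm_def b_def
      by (auto intro!: real_sqrt_le_mono sum_mono power_mono)
  qed
  show ?thesis
    unfolding op_norm_def
    by (rule cSUP_upper) (use v v1 bound in \<open>auto intro!: bdd_aboveI2[where M = b]\<close>)
qed

section \<open>Functional calculus in a fixed eigenbasis\<close>

definition spectral_fun ::
  "nat \<Rightarrow> (nat \<Rightarrow> complex vec) \<Rightarrow> (nat \<Rightarrow> complex) \<Rightarrow> complex mat" where
  "spectral_fun N e f = mat N N (\<lambda>(a, b). \<Sum>j<N. f j * (e j $ a) * cnj (e j $ b))"

text \<open>A component sum in place of \<open>\<bullet>c\<close> keeps carrier conditions out of
  the calculus and matches the hypothesis of \<open>sum_cmod_orthonormal\<close>.\<close>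

definition orthonormal :: "nat \<Rightarrow> (nat \<Rightarrow> complex vec) \<Rightarrow> bool" where
  "orthonormal N e \<longleftrightarrow>
     (\<forall>i<N. \<forall>j<N. (\<Sum>a<N. e i $ a * cnj (e j $ a)) = (if i = j then 1 else 0))"

lemma spectral_fun_carrier [simp]: "spectral_fun N e f \<in> carrier_mat N N"
  and dim_spectral_fun [simp]:
    "dim_row (spectral_fun N e f) = N" "dim_col (spectral_fun N e f) = N"
  by (simp_all add: spectral_fun_def)

lemma orthonormal_if_spectral_decomposition:
  assumes "spectral_decomposition N H E e"
  shows "orthonormal N e"
  unfolding orthonormal_def
proof (intro allI impI)
  fix i j assume ij: "i < N" "j < N"
  have "e i \<bullet>c e j = (\<Sum>a<N. e i $ a * cnj (e j $ a))"
    using assms ij by (simp add: spectral_decomposition_def scalar_prod_def atLeast0LessThan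
        carrier_vecD[of "e j" N])
  then show "(\<Sum>a<N. e i $ a * cnj (e j $ a)) = (if i = j then 1 else 0)"
    using assms ij unfolding spectral_decomposition_def by metis
qed

lemma spectral_decomposition_eq_spectral_fun:
  "spectral_decomposition N H E e \<Longrightarrow> H = spectral_fun N e (\<lambda>j. complex_of_real (E j))"
  by (simp add: spectral_decomposition_def spectral_fun_def)

lemma spectral_fun_mult_combination:
  assumes "orthonormal N e"
  shows "spectral_fun N e f *\<^sub>v vec N (\<lambda>a. \<Sum>j<N. c j * (e j $ a))
    = vec N (\<lambda>a. \<Sum>j<N. f j * c j * (e j $ a))"
proof (rule eq_vecI)
  fix a assume "a < dim_vec (vec N (\<lambda>a. \<Sum>j<N. f j * c j * (e j $ a)))"
  then have a: "a < N" by simp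
  have "(spectral_fun N e f *\<^sub>v vec N (\<lambda>a. \<Sum>j<N. c j * (e j $ a))) $ a
     = (\<Sum>b<N. (\<Sum>i<N. f i * (e i $ a) * cnj (e i $ b)) * (\<Sum>j<N. c j * (e j $ b)))"
    using a by (subst index_mult_mat_vec_sum) (auto simp: spectral_fun_def intro!: sum.cong)
  also have "\<dots> = (\<Sum>b<N. \<Sum>i<N. \<Sum>j<N. f i * c j * (e i $ a) * (e j $ b * cnj (e i $ b)))"
    unfolding sum_product by (intro sum.cong refl) (simp add: mult_ac)
  also have "\<dots> = (\<Sum>i<N. \<Sum>j<N. f i * c j * (e i $ a) * (\<Sum>b<N. e j $ b * cnj (e i $ b)))"
    by (subst sum.swap, rule sum.cong[OF refl], subst sum.swap) (simp add: sum_distrib_left)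
  also have "\<dots> = (\<Sum>i<N. \<Sum>j<N. if j = i then f i * c j * (e i $ a) else 0)"
    using assms by (intro sum.cong refl) (auto simp: orthonormal_def)
  also have "\<dots> = (\<Sum>j<N. f j * c j * (e j $ a))"
    by (simp add: sum.delta)
  finally show "(spectral_fun N e f *\<^sub>v vec N (\<lambda>a. \<Sum>j<N. c j * (e j $ a))) $ a
      = vec N (\<lambda>a. \<Sum>j<N. f j * c j * (e j $ a)) $ a"
    using a by simp
qed simp

lemma spectral_fun_mult:
  assumes "orthonormal N e"
  shows "spectral_fun N e f * spectral_fun N e g = spectral_fun N e (\<lambda>j. f j * g j)"
proof (rule eq_matI)
  fix a b assume "a < dim_row (spectral_fun N e (\<lambda>j. f j * g j))"
    "b < dim_col (spectral_fun N e (\<lambda>j. f j * g j))"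
  then have ab: "a < N" "b < N" by simp_all
  have "col (spectral_fun N e g) b = vec N (\<lambda>a. \<Sum>j<N. (g j * cnj (e j $ b)) * (e j $ a))"
    using ab by (intro eq_vecI) (auto simp: spectral_fun_def mult_ac)
  then have "col (spectral_fun N e f * spectral_fun N e g) b
     = vec N (\<lambda>a. \<Sum>j<N. f j * (g j * cnj (e j $ b)) * (e j $ a))"
    using ab by (simp add: col_mult2[where nr = N and n = N and nc = N]
        spectral_fun_mult_combination[OF assms])
  then have "col (spectral_fun N e f * spectral_fun N e g) b $ a
     = (\<Sum>j<N. f j * (g j * cnj (e j $ b)) * (e j $ a))"
    using ab by simp
  then show "(spectral_fun N e f * spectral_fun N e g) $$ (a, b)
      = spectral_fun N e (\<lambda>j. f j * g j) $$ (a, b)"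
    using ab by (simp add: spectral_fun_def mult_ac)
qed simp_all

text \<open>Orthonormality says that the matrix \<open>V\<close> of eigenvectors has the left
  inverse \<open>W\<close>. For square matrices this is also a right inverse, and
  \<open>V * W\<close> is the resolution of the identity.\<close>

lemma spectral_fun_one:
  assumes "orthonormal N e"
  shows "spectral_fun N e (\<lambda>_. 1) = 1\<^sub>m N"
proof -
  define V where "V = mat N N (\<lambda>(a, j). e j $ a)"
  define W where "W = mat N N (\<lambda>(j, a). cnj (e j $ a))"
  have "W * V = 1\<^sub>m N"
  proof (rule eq_matI)
    fix i j assume "i < dim_row (1\<^sub>m N :: complex mat)" "j < dim_col (1\<^sub>m N :: complex mat)"
    then have ij: "i < N" "j < N" by simp_all
    have "(W * V) $$ (i, j) = (\<Sum>a<N. e j $ a * cnj (e i $ a))"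
      using ij by (subst index_mult_mat_sum) (auto simp: W_def V_def mult.commute)
    then show "(W * V) $$ (i, j) = 1\<^sub>m N $$ (i, j)"
      using assms ij by (auto simp: orthonormal_def)
  qed (simp_all add: W_def V_def)
  then have VW: "V * W = 1\<^sub>m N"
    by (rule mat_mult_left_right_inverse[rotated 2]) (auto simp: W_def V_def)
  have "spectral_fun N e (\<lambda>_. 1) = V * W"
    by (rule eq_matI) (auto simp: spectral_fun_def V_def W_def scalar_prod_def atLeast0LessThan)
  then show ?thesis
    by (simp add: VW)
qed

lemma spectral_fun_pow:
  assumes "orthonormal N e"
  shows "spectral_fun N e f ^\<^sub>m k = spectral_fun N e (\<lambda>j. f j ^ k)"
proof (induction k)
  case 0
  then show ?case by (simp add: spectral_fun_one[OF assms])
next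
  case (Suc k)
  then show ?case by (simp add: spectral_fun_mult[OF assms] mult.commute)
qed

text \<open>Powers act on the eigenvalues alone, so every entry of the series is a finite linear
  combination of scalar exponential series.\<close>

lemma mat_exp_spectral_fun:
  assumes "orthonormal N e"
  shows "mat_exp (spectral_fun N e f) = spectral_fun N e (\<lambda>j. exp (f j))"
proof -
  have "(\<lambda>k. (\<Sum>j<N. f j ^ k * (e j $ a) * cnj (e j $ b)) / fact k)
      sums (\<Sum>j<N. exp (f j) * (e j $ a) * cnj (e j $ b))" for a b
  proof -
    have "(\<lambda>k. \<Sum>j<N. (f j ^ k /\<^sub>R fact k) * ((e j $ a) * cnj (e j $ b)))
      sums (\<Sum>j<N. exp (f j) * ((e j $ a) * cnj (e j $ b)))"
      by (intro sums_sum sums_mult2 exp_converges)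
    then show ?thesis
      by (simp only: sum_divide_distrib) (simp add: scaleR_conv_of_real divide_inverse mult_ac)
  qed
  from sums_unique[OF this] show ?thesis
    unfolding mat_exp_def spectral_fun_pow[OF assms]
    by (auto simp: spectral_fun_def intro!: eq_matI)
qed

lemma spectral_fun_smult: "c \<cdot>\<^sub>m spectral_fun N e f = spectral_fun N e (\<lambda>j. c * f j)"
  by (rule eq_matI) (auto simp: spectral_fun_def sum_distrib_left mult.assoc)

lemma spectral_fun_minus:
  "spectral_fun N e f - spectral_fun N e g = spectral_fun N e (\<lambda>j. f j - g j)"
  by (rule eq_matI) (auto simp: spectral_fun_def sum_subtractf left_diff_distrib)

lemma gaussian_of_eq_spectral_fun:
  assumes "spectral_decomposition (2 ^ n) H E e"
  shows "gaussian_of n H \<xi> s =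
    spectral_fun (2 ^ n) e (\<lambda>j. complex_of_real (exp (- ((E j - \<xi>)\<^sup>2 / (2 * s\<^sup>2)))))"
proof -
  note on = orthonormal_if_spectral_decomposition[OF assms]
  show ?thesis
    unfolding gaussian_of_def spectral_decomposition_eq_spectral_fun[OF assms]
      spectral_fun_one[OF on, symmetric] spectral_fun_smult spectral_fun_minus
      spectral_fun_pow[OF on] mat_exp_spectral_fun[OF on]
    by (simp flip: exp_of_real)
qed

text \<open>This is the success probability of an exact block-encoding. Squaring the amplitude
  cancels the 2 in the exponent of the Gaussian.\<close>

lemma power2_vec_norm_gaussian_of:
  assumes sd: "spectral_decomposition (2 ^ n) H E e"
    and \<psi>: "\<psi> = vec (2 ^ n) (\<lambda>a. \<Sum>j<2 ^ n. \<gamma> j * (e j $ a))"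
  shows "(vec_norm (gaussian_of n H \<xi> s *\<^sub>v \<psi>))\<^sup>2
    = (\<Sum>j<2 ^ n. (cmod (\<gamma> j))\<^sup>2 * exp (- ((E j - \<xi>) / s)\<^sup>2))"
proof -
  note on = orthonormal_if_spectral_decomposition[OF sd]
  have "(vec_norm (gaussian_of n H \<xi> s *\<^sub>v \<psi>))\<^sup>2
    = (\<Sum>j<2 ^ n. (cmod (complex_of_real (exp (- ((E j - \<xi>)\<^sup>2 / (2 * s\<^sup>2)))) * \<gamma> j))\<^sup>2)"
    unfolding gaussian_of_eq_spectral_fun[OF sd] \<psi> spectral_fun_mult_combination[OF on]
      power2_vec_norm
    by (simp, rule sum_cmod_orthonormal) (use on in \<open>auto simp: orthonormal_def\<close>)
  also have "\<dots> = (\<Sum>j<2 ^ n. (cmod (\<gamma> j))\<^sup>2 * exp (- ((E j - \<xi>) / s)\<^sup>2))"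
  proof (rule sum.cong)
    fix j
    have "(exp (- ((E j - \<xi>)\<^sup>2 / (2 * s\<^sup>2))))\<^sup>2 = exp (- ((E j - \<xi>) / s)\<^sup>2)"
      unfolding power2_eq_square[of "exp _"] by (simp add: power_divide field_simps flip: exp_add)
    then show "(cmod (complex_of_real (exp (- ((E j - \<xi>)\<^sup>2 / (2 * s\<^sup>2)))) * \<gamma> j))\<^sup>2 =
         (cmod (\<gamma> j))\<^sup>2 * exp (- ((E j - \<xi>) / s)\<^sup>2)"
      by (simp add: norm_mult power_mult_distrib mult.commute)
  qed simp
  finally show ?thesis .
qed

lemma sum_weights_eq_1:
  assumes on: "orthonormal N e" and \<psi>: "\<psi> = vec N (\<lambda>a. \<Sum>j<N. \<gamma> j * (e j $ a))"
    and "vec_norm \<psi> = 1"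
  shows "(\<Sum>j<N. (cmod (\<gamma> j))\<^sup>2) = 1"
proof -
  have "(vec_norm \<psi>)\<^sup>2 = (\<Sum>j<N. (cmod (\<gamma> j))\<^sup>2)"
    unfolding power2_vec_norm \<psi>
    by (simp, rule sum_cmod_orthonormal) (use on in \<open>auto simp: orthonormal_def\<close>)
  then show ?thesis
    using assms by simp
qed

lemma vec_norm_reverse_triangle:
  assumes "v \<in> carrier_vec d" "w \<in> carrier_vec d"
  shows "\<bar>vec_norm v - vec_norm w\<bar> \<le> vec_norm (v - w)"
proof -
  have L2: "vec_norm x = L2_set (\<lambda>i. cmod (x $ i)) {..<d}" if "x \<in> carrier_vec d" for x
    using that by (simp add: vec_norm_def L2_set_def)
  have tri: "vec_norm x \<le> vec_norm y + vec_norm (x - y)"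
    if x: "x \<in> carrier_vec d" and y: "y \<in> carrier_vec d" for x y
  proof -
    have "vec_norm x \<le> L2_set (\<lambda>i. cmod (y $ i) + cmod ((x - y) $ i)) {..<d}"
      unfolding L2[OF x] using x y
      by (intro L2_set_mono) (auto intro: norm_triangle_sub)
    also have "\<dots> \<le> vec_norm y + vec_norm (x - y)"
      using x y by (simp only: L2 minus_carrier_vec L2_set_triangle_ineq)
    finally show ?thesis .
  qed
  have "vec_norm (w - v) = vec_norm (v - w)"
    using assms by (auto simp: vec_norm_def norm_minus_commute intro!: sum.cong)
  then show ?thesis
    using tri[OF assms] tri[OF assms(2,1)] by linarith
qed

section \<open>Concentration for independent rounds\<close>

definition outcomes :: "nat \<Rightarrow> nat \<Rightarrow> nat list set" where
  "outcomes K t = {ks. set ks \<subseteq> {..<K} \<and> length ks = t}"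

lemma finite_outcomes [simp]: "finite (outcomes K t)"
  unfolding outcomes_def by (rule finite_lists_length_eq) simp

lemma outcomes_0 [simp]: "outcomes K 0 = {[]}"
  by (auto simp: outcomes_def)

lemma sum_outcomes_Suc:
  "(\<Sum>ks\<in>outcomes K (Suc t). f ks) = (\<Sum>ks\<in>outcomes K t. \<Sum>k<K. f (k # ks))"
proof -
  have eq: "outcomes K (Suc t) = (\<lambda>(ks, k). k # ks) ` (outcomes K t \<times> {..<K})"
    by (force simp: outcomes_def length_Suc_conv image_iff)
  have "(\<Sum>ks\<in>outcomes K (Suc t). f ks) = (\<Sum>(ks, k)\<in>outcomes K t \<times> {..<K}. f (k # ks))"
    unfolding eq by (subst sum.reindex) (auto simp: inj_on_def case_prod_unfold)
  then show ?thesis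
    by (simp add: sum.cartesian_product)
qed

text \<open>The union bound, later applied to the failures of the three estimates.\<close>

lemma sum_UN_le:
  fixes f :: "'a \<Rightarrow> real"
  assumes "finite I" "\<And>i. i \<in> I \<Longrightarrow> finite (S i)" "\<And>x. 0 \<le> f x"
  shows "sum f (\<Union>i\<in>I. S i) \<le> (\<Sum>i\<in>I. sum f (S i))"
  using assms(1,2)
proof (induction I)
  case (insert i I)
  have "sum f (S i \<union> (\<Union>i\<in>I. S i)) + sum f (S i \<inter> (\<Union>i\<in>I. S i)) = sum f (S i) + sum f (\<Union>i\<in>I. S i)"
    by (rule sum.union_inter) (use insert in auto)
  moreover have "0 \<le> sum f (S i \<inter> (\<Union>i\<in>I. S i))"
    by (rule sum_nonneg) (rule assms(3))
  ultimately show ?case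
    using insert by auto
qed simp

text \<open>
  Outcome lists are most recent first, like histories, so the outcome in front of \<open>ks\<close> belongs to
  round \<open>length ks\<close>.
\<close>

primrec weight :: "(nat \<Rightarrow> nat \<Rightarrow> real) \<Rightarrow> nat list \<Rightarrow> real" where
  "weight p [] = 1"
| "weight p (k # ks) = p (length ks) k * weight p ks"

primrec score :: "(nat \<Rightarrow> nat \<Rightarrow> real) \<Rightarrow> nat list \<Rightarrow> real" where
  "score X [] = 0"
| "score X (k # ks) = X (length ks) k + score X ks"

lemma weight_nonneg:
  assumes "\<And>t k. 0 \<le> p t k"
  shows "0 \<le> weight p ks"
  by (induction ks) (auto simp: assms)

lemma sum_weight:
  assumes "\<And>t. t < T \<Longrightarrow> (\<Sum>k<K. p t k) = 1" "t \<le> T"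
  shows "(\<Sum>ks\<in>outcomes K t. weight p ks) = 1"
  using \<open>t \<le> T\<close>
proof (induction t)
  case (Suc t)
  have "(\<Sum>ks\<in>outcomes K (Suc t). weight p ks)
      = (\<Sum>ks\<in>outcomes K t. (\<Sum>k<K. p t k) * weight p ks)"
    unfolding sum_outcomes_Suc by (intro sum.cong) (auto simp: sum_distrib_right outcomes_def)
  then show ?case
    using Suc assms(1)[of t] by simp
qed simp

text \<open>The second-order bound behind the moment generating function. For \<open>y = - x\<close>
  negative, it is multiplied by \<open>exp x\<close>: the product of
  \<open>1 - x + x\<^sup>2\<close> with the Taylor lower bound of \<open>exp x\<close> is already at
  least 1.\<close>

lemma exp_le_quadratic:
  fixes y :: real
  assumes "\<bar>y\<bar> \<le> 1"
  shows "exp y \<le> 1 + y + y\<^sup>2"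
proof (cases "0 \<le> y")
  case True
  then show ?thesis using exp_bound[of y] assms by simp
next
  case False
  define x where "x = - y"
  have x: "0 \<le> x" using False by (simp add: x_def)
  have "1 \<le> (1 - x + x\<^sup>2) * (1 + x + x\<^sup>2 / 2)"
  proof -
    have "(1 - x + x\<^sup>2) * (1 + x + x\<^sup>2 / 2) = 1 + x\<^sup>2 / 2 + x ^ 3 / 2 + x ^ 4 / 2"
      by (simp add: field_simps power2_eq_square power3_eq_cube power4_eq_xxxx)
    then show ?thesis using x by simp
  qed
  also have "\<dots> \<le> (1 - x + x\<^sup>2) * exp x"
  proof (rule mult_left_mono)
    have "0 \<le> (1 - x)\<^sup>2 + x" using x by simp
    then show "0 \<le> 1 - x + x\<^sup>2" using x by (simp add: power2_eq_square algebra_simps)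
  qed (rule exp_lower_Taylor_quadratic[OF x])
  finally show ?thesis
    by (simp add: x_def exp_minus field_simps)
qed

text \<open>Since \<open>weight\<close> is a product over rounds, each round contributes a separate
  factor. The linear term of \<open>exp_le_quadratic\<close> vanishes because the increments are
  centred, which leaves \<open>1 + l\<^sup>2 \<le> exp (l\<^sup>2)\<close> per round.\<close>

lemma moment_generating_bound:
  assumes p: "\<And>t k. 0 \<le> p t k" and p1: "\<And>t. t < T \<Longrightarrow> (\<Sum>k<K. p t k) = 1"
    and mean: "\<And>t. t < T \<Longrightarrow> (\<Sum>k<K. p t k * X t k) = 0"
    and X: "\<And>t k. t < T \<Longrightarrow> k < K \<Longrightarrow> \<bar>X t k\<bar> \<le> 1"
    and l: "\<bar>l\<bar> \<le> 1" and "t \<le> T"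
  shows "(\<Sum>ks\<in>outcomes K t. weight p ks * exp (l * score X ks)) \<le> exp (l\<^sup>2 * t)"
  using \<open>t \<le> T\<close>
proof (induction t)
  case (Suc t)
  have step: "(\<Sum>k<K. p t k * exp (l * X t k)) \<le> exp (l\<^sup>2)"
  proof -
    have "(\<Sum>k<K. p t k * exp (l * X t k)) \<le> (\<Sum>k<K. p t k * (1 + l * X t k + l\<^sup>2))"
    proof (intro sum_mono mult_left_mono p)
      fix k assume "k \<in> {..<K}"
      then have Xk: "\<bar>X t k\<bar> \<le> 1" using X Suc.prems by simp
      then have "\<bar>l * X t k\<bar> \<le> 1"
        using mult_mono[OF l Xk] by (simp add: abs_mult)
      then have "exp (l * X t k) \<le> 1 + l * X t k + (l * X t k)\<^sup>2"
        by (rule exp_le_quadratic)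
      also have "(l * X t k)\<^sup>2 \<le> l\<^sup>2"
        using Xk by (simp add: power_mult_distrib mult_left_le abs_square_le_1)
      finally show "exp (l * X t k) \<le> 1 + l * X t k + l\<^sup>2" by simp
    qed
    also have "\<dots> = (1 + l\<^sup>2) * (\<Sum>k<K. p t k) + l * (\<Sum>k<K. p t k * X t k)"
      by (simp add: sum_distrib_left sum_distrib_right sum.distrib algebra_simps)
    also have "\<dots> = 1 + l\<^sup>2"
      using p1 mean Suc.prems by simp
    also have "\<dots> \<le> exp (l\<^sup>2)" by simp
    finally show ?thesis .
  qed
  have "(\<Sum>ks\<in>outcomes K (Suc t). weight p ks * exp (l * score X ks))
      = (\<Sum>ks\<in>outcomes K t. (\<Sum>k<K. p t k * exp (l * X t k)) * (weight p ks * exp (l * score X ks)))"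
    unfolding sum_outcomes_Suc
    by (intro sum.cong)
      (auto simp: sum_distrib_left sum_distrib_right outcomes_def distrib_left exp_add mult_ac)
  also have "\<dots> \<le> (\<Sum>ks\<in>outcomes K t. exp (l\<^sup>2) * (weight p ks * exp (l * score X ks)))"
    by (intro sum_mono mult_right_mono step) (simp add: weight_nonneg p)
  also have "\<dots> \<le> exp (l\<^sup>2) * exp (l\<^sup>2 * t)"
    using Suc by (simp add: sum_distrib_left[symmetric])
  also have "\<dots> = exp (l\<^sup>2 * Suc t)"
    by (simp add: exp_add[symmetric] algebra_simps)
  finally show ?case .
qed simp

text \<open>Markov's inequality for the sum of \<open>exp (l * score X ks)\<close> and
  \<open>exp (- l * score X ks)\<close> treats both tails at once, whence the factor 2. The
  parameter \<open>l\<close> stays free for later optimisation.\<close>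

lemma chernoff_bound:
  assumes p: "\<And>t k. 0 \<le> p t k" and p1: "\<And>t. t < T \<Longrightarrow> (\<Sum>k<K. p t k) = 1"
    and mean: "\<And>t. t < T \<Longrightarrow> (\<Sum>k<K. p t k * X t k) = 0"
    and X: "\<And>t k. t < T \<Longrightarrow> k < K \<Longrightarrow> \<bar>X t k\<bar> \<le> 1"
    and l: "0 \<le> l" "l \<le> 1"
  shows "(\<Sum>ks\<in>{ks \<in> outcomes K T. a \<le> \<bar>score X ks\<bar>}. weight p ks) \<le> 2 * exp (l\<^sup>2 * T - l * a)"
proof -
  have "(\<Sum>ks\<in>{ks \<in> outcomes K T. a \<le> \<bar>score X ks\<bar>}. weight p ks)
     \<le> (\<Sum>ks\<in>{ks \<in> outcomes K T. a \<le> \<bar>score X ks\<bar>}.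
          weight p ks * ((exp (l * score X ks) + exp (- l * score X ks)) * exp (- (l * a))))"
  proof (rule sum_mono)
    fix ks assume "ks \<in> {ks \<in> outcomes K T. a \<le> \<bar>score X ks\<bar>}"
    then have "l * a \<le> l * \<bar>score X ks\<bar>" using l by (simp add: mult_left_mono)
    then have "exp (l * a) \<le> exp (l * \<bar>score X ks\<bar>)" by simp
    also have "\<dots> \<le> exp (l * score X ks) + exp (- l * score X ks)"
      by (cases "0 \<le> score X ks") (auto simp: abs_if)
    finally have "1 \<le> (exp (l * score X ks) + exp (- l * score X ks)) * exp (- (l * a))"
      by (simp add: exp_minus field_simps)
    then show "weight p ks
        \<le> weight p ks * ((exp (l * score X ks) + exp (- l * score X ks)) * exp (- (l * a)))"
      using mult_left_mono[OF _ weight_nonneg[of p ks, OF p], of 1] by simp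
  qed
  also have "\<dots> \<le> (\<Sum>ks\<in>outcomes K T.
      weight p ks * ((exp (l * score X ks) + exp (- l * score X ks)) * exp (- (l * a))))"
  proof (rule sum_mono2)
    show "0 \<le> weight p ks * ((exp (l * score X ks) + exp (- l * score X ks)) * exp (- (l * a)))" for ks
      by (intro mult_nonneg_nonneg add_nonneg_nonneg weight_nonneg p) simp_all
  qed auto
  also have "\<dots> = ((\<Sum>ks\<in>outcomes K T. weight p ks * exp (l * score X ks))
      + (\<Sum>ks\<in>outcomes K T. weight p ks * exp (- l * score X ks))) * exp (- (l * a))"
    by (simp add: sum_distrib_left sum_distrib_right sum.distrib algebra_simps)
  also have "\<dots> \<le> (exp (l\<^sup>2 * T) + exp ((- l)\<^sup>2 * T)) * exp (- (l * a))"
    using l by (intro mult_right_mono add_mono moment_generating_bound[where T = T] assms) auto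
  also have "\<dots> = 2 * exp (l\<^sup>2 * T - l * a)"
    by (simp add: exp_diff exp_minus field_simps)
  finally show ?thesis .
qed

section \<open>Repeated preparation, query and measurement\<close>

text \<open>
  The coin outcome \<open>1\<close> is followed by four outcomes per round, of which only the last one, that of
  the measurement, is not forced to be \<open>0\<close>.
\<close>

fun encode :: "nat list \<Rightarrow> nat list" where
  "encode [] = [1]"
| "encode (k # ks) = k # 0 # 0 # 0 # encode ks"

text \<open>Each step keeps the measurement outcome and drops the three forced outcomes before it in
  time; the last equation discards the coin outcome.\<close>

fun decode :: "nat list \<Rightarrow> nat list" where
  "decode (k # _ # _ # _ # h) = k # decode h"
| "decode h = []"

definition coin :: "real \<Rightarrow> complex mat list" where
  "coin q = [complex_of_real (sqrt q) \<cdot>\<^sub>m 1\<^sub>m 1, complex_of_real (sqrt (1 - q)) \<cdot>\<^sub>m 1\<^sub>m 1]"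

text \<open>The Kraus operators are the bras of the computational basis, so that measuring also
  discards all qubits. As the ancilla of the block-encoding is the most significant qubit, outcomes
  below half of \<open>d\<close> are those with the ancilla in state 0.\<close>

definition measurement :: "nat \<Rightarrow> complex mat list" where
  "measurement d = map (\<lambda>k. mat 1 d (\<lambda>(i, j). if j = k then 1 else 0)) [0..<d]"

text \<open>Histories are most recent first, so \<open>last h\<close> is the coin outcome. Without
  it, the length of the history gives the round \<open>t\<close> and the position \<open>r\<close>
  within the round. The estimate \<open>x\<close> is the one rejected at once on coin outcome
  0.\<close>

definition sampling_algorithm ::
  "nat \<Rightarrow> real \<Rightarrow> real \<Rightarrow> (nat \<Rightarrow> real) \<Rightarrow> real \<Rightarrow> real \<Rightarrow> nat \<Rightarrow> (nat list \<Rightarrow> real \<times> bool) \<Rightarrow> algorithm"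
where
  "sampling_algorithm n q x \<xi> s \<epsilon>' T D h =
     (if h = [] then Instrument 0 (coin q)
      else if last h = 0 then Halt x False
      else let t = (length h - 1) div 4; r = (length h - 1) mod 4 in
        if T \<le> t then Halt (fst (D (decode h))) (snd (D (decode h)))
        else if r = 0 then Instrument 1 [ket_zeros 1]
        else if r = 1 then Prepare
        else if r = 2 then Query (\<xi> t) s \<epsilon>'
        else Instrument 0 (measurement (2 ^ (n + 1))))"

lemma length_encode [simp]: "length (encode ks) = Suc (4 * length ks)"
  by (induction ks) auto

lemma encode_not_Nil [simp]: "encode ks \<noteq> []"
  by (cases ks) auto

lemma last_encode [simp]: "last (encode ks) = 1"
  by (induction ks) auto

lemma decode_encode [simp]: "decode (encode ks) = ks"
  by (induction ks) auto

lemma inj_encode: "inj encode"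
  by (metis decode_encode injI)

lemma sampling_algorithm_simps [simp]:
  "sampling_algorithm n q x \<xi> s \<epsilon>' T D [] = Instrument 0 (coin q)"
  "sampling_algorithm n q x \<xi> s \<epsilon>' T D [0] = Halt x False"
  "T \<le> length ks \<Longrightarrow> sampling_algorithm n q x \<xi> s \<epsilon>' T D (encode ks) = Halt (fst (D ks)) (snd (D ks))"
  "length ks < T \<Longrightarrow> sampling_algorithm n q x \<xi> s \<epsilon>' T D (encode ks) = Instrument 1 [ket_zeros 1]"
  "length ks < T \<Longrightarrow> sampling_algorithm n q x \<xi> s \<epsilon>' T D (0 # encode ks) = Prepare"
  "length ks < T \<Longrightarrow> sampling_algorithm n q x \<xi> s \<epsilon>' T D (0 # 0 # encode ks) = Query (\<xi> (length ks)) s \<epsilon>'"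
  "length ks < T \<Longrightarrow> sampling_algorithm n q x \<xi> s \<epsilon>' T D (0 # 0 # 0 # encode ks)
     = Instrument 0 (measurement (2 ^ (n + 1)))"
proof -
  have [simp]: "Suc (4 * l) div 4 = l" "Suc (Suc (4 * l)) div 4 = l" "Suc (Suc (Suc (4 * l))) div 4 = l"
    "Suc (4 * l) mod 4 = 1" "Suc (Suc (4 * l)) mod 4 = 2" "Suc (Suc (Suc (4 * l))) mod 4 = 3" for l :: nat
    by presburger+
  show
    "sampling_algorithm n q x \<xi> s \<epsilon>' T D [] = Instrument 0 (coin q)"
    "sampling_algorithm n q x \<xi> s \<epsilon>' T D [0] = Halt x False"
    "T \<le> length ks \<Longrightarrow> sampling_algorithm n q x \<xi> s \<epsilon>' T D (encode ks) = Halt (fst (D ks)) (snd (D ks))"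
    "length ks < T \<Longrightarrow> sampling_algorithm n q x \<xi> s \<epsilon>' T D (encode ks) = Instrument 1 [ket_zeros 1]"
    "length ks < T \<Longrightarrow> sampling_algorithm n q x \<xi> s \<epsilon>' T D (0 # encode ks) = Prepare"
    "length ks < T \<Longrightarrow> sampling_algorithm n q x \<xi> s \<epsilon>' T D (0 # 0 # encode ks) = Query (\<xi> (length ks)) s \<epsilon>'"
    "length ks < T \<Longrightarrow> sampling_algorithm n q x \<xi> s \<epsilon>' T D (0 # 0 # 0 # encode ks)
       = Instrument 0 (measurement (2 ^ (n + 1)))"
    by (simp_all add: sampling_algorithm_def)
qed

lemma length_coin [simp]: "length (coin q) = 2"
  and length_measurement [simp]: "length (measurement d) = d"
  by (simp_all add: coin_def measurement_def)

text \<open>This classification turns the sums over histories in \<open>output_prob\<close> and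
  \<open>expected_queries\<close> into finite sums over outcome lists. The three extra shapes are
  the intermediate positions within a round.\<close>

lemma reachable_sampling_algorithm:
  "reachable (sampling_algorithm n q x \<xi> s \<epsilon>' T D) h \<longleftrightarrow>
     h = [] \<or> h = [0] \<or>
     (\<exists>ks. set ks \<subseteq> {..<2 ^ (n + 1)} \<and> length ks \<le> T \<and> h = encode ks) \<or>
     (\<exists>ks. set ks \<subseteq> {..<2 ^ (n + 1)} \<and> length ks < T \<and>
        h \<in> {0 # encode ks, 0 # 0 # encode ks, 0 # 0 # 0 # encode ks})"
    (is "reachable ?A h \<longleftrightarrow> ?R h")
proof
  show "reachable ?A h \<Longrightarrow> ?R h"
  proof (induction h)
    case (Cons k h)
    then have "?R h" by simp
    then consider "h = []" | "h = [0]"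
      | ks where "set ks \<subseteq> {..<2 ^ (n + 1)}" "length ks \<le> T" "h = encode ks"
      | ks where "set ks \<subseteq> {..<2 ^ (n + 1)}" "length ks < T" "h = 0 # encode ks"
      | ks where "set ks \<subseteq> {..<2 ^ (n + 1)}" "length ks < T" "h = 0 # 0 # encode ks"
      | ks where "set ks \<subseteq> {..<2 ^ (n + 1)}" "length ks < T" "h = 0 # 0 # 0 # encode ks"
      by blast
    then show ?case
    proof cases
      case 1
      then have "k = 0 \<or> k = 1" using Cons.prems by auto
      then show ?thesis
      proof
        assume "k = 1"
        then have "k # h = encode []" using 1 by simp
        then show ?thesis by (metis le0 empty_subsetI list.set(1) list.size(3))
      qed (simp add: 1)
    next
      case 2
      then show ?thesis using Cons.prems by simp
    next
      case (3 ks)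
      then have "length ks < T \<and> k = 0"
        using Cons.prems by (cases "length ks < T") auto
      then show ?thesis using 3 by blast
    next
      case (4 ks)
      then have "k = 0" using Cons.prems by simp
      then show ?thesis using 4 by blast
    next
      case (5 ks)
      then have "k = 0" using Cons.prems by simp
      then show ?thesis using 5 by blast
    next
      case (6 ks)
      then have "k < 2 ^ (n + 1)" using Cons.prems by simp
      then have "set (k # ks) \<subseteq> {..<2 ^ (n + 1)}" "length (k # ks) \<le> T" "k # h = encode (k # ks)"
        using 6 by simp_all
      then show ?thesis by blast
    qed
  qed simp
next
  have enc: "reachable ?A (encode ks)"
    if "set ks \<subseteq> {..<2 ^ (n + 1)}" "length ks \<le> T" for ks
    using that
  proof (induction ks)
    case (Cons k ks)
    then have "reachable ?A (encode ks)" "length ks < T" "k < 2 ^ (n + 1)" by simp_all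
    then show ?case by simp
  qed simp
  assume "?R h"
  then show "reachable ?A h"
  proof (elim disjE exE conjE)
    fix ks assume ks: "set ks \<subseteq> {..<2 ^ (n + 1)}" "length ks < T"
      "h \<in> {0 # encode ks, 0 # 0 # encode ks, 0 # 0 # 0 # encode ks}"
    then have "reachable ?A (encode ks)" using enc[of ks] by simp
    then show ?thesis using ks by auto
  qed (use enc in \<open>simp_all add: coin_def\<close>)
qed

section \<open>Completeness of the Kraus operators\<close>

lemma foldr_add_mat:
  assumes "\<And>K. K \<in> set Ks \<Longrightarrow> F K \<in> carrier_mat d d"
  shows "foldr (+) (map F Ks) (0\<^sub>m d d) \<in> carrier_mat d d \<and>
    (\<forall>i<d. \<forall>j<d. foldr (+) (map F Ks) (0\<^sub>m d d) $$ (i, j) = (\<Sum>K\<leftarrow>Ks. F K $$ (i, j)))"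
  using assms by (induction Ks) auto

text \<open>Matrices of all sizes share one type, so the carrier of the partial sums must be
  tracked, which \<open>foldr_add_mat\<close> does. Afterwards the concrete instruments can be
  checked entry by entry.\<close>

lemma kraus_complete_iff:
  assumes "\<And>K. K \<in> set Ks \<Longrightarrow> dim_col K = d"
  shows "kraus_complete d Ks \<longleftrightarrow> (\<forall>i<d. \<forall>j<d.
     (\<Sum>K\<leftarrow>Ks. \<Sum>r<dim_row K. cnj (K $$ (r, i)) * K $$ (r, j)) = (if i = j then 1 else 0))"
proof -
  have *: "(mat_adjoint K * K) $$ (i, j) = (\<Sum>r<dim_row K. cnj (K $$ (r, i)) * K $$ (r, j))"
    if "K \<in> set Ks" "i < d" "j < d" for K i j
    using that assms by (subst index_mult_mat_sum) (auto simp: index_mat_adjoint)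
  have c: "mat_adjoint K * K \<in> carrier_mat d d" if "K \<in> set Ks" for K
    using assms[OF that] by auto
  have eq: "(\<Sum>K\<leftarrow>Ks. (mat_adjoint K * K) $$ (i, j))
      = (\<Sum>K\<leftarrow>Ks. \<Sum>r<dim_row K. cnj (K $$ (r, i)) * K $$ (r, j))" if "i < d" "j < d" for i j
    using * that by (auto intro!: arg_cong[where f = sum_list])
  note F = foldr_add_mat[of Ks "\<lambda>K. mat_adjoint K * K" d, OF c]
  have "foldr (+) (map (\<lambda>K. mat_adjoint K * K) Ks) (0\<^sub>m d d) = 1\<^sub>m d \<longleftrightarrow>
    (\<forall>i<d. \<forall>j<d. (\<Sum>K\<leftarrow>Ks. (mat_adjoint K * K) $$ (i, j)) = (1\<^sub>m d :: complex mat) $$ (i, j))"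
    (is "?M = _ \<longleftrightarrow> ?R")
  proof
    show "?M = 1\<^sub>m d \<Longrightarrow> ?R" using F by metis
    show "?R \<Longrightarrow> ?M = 1\<^sub>m d" by (rule eq_matI) (use F in auto)
  qed
  then show ?thesis
    unfolding kraus_complete_def by (simp add: eq)
qed

lemma kraus_complete_coin:
  assumes "0 \<le> q" "q \<le> 1"
  shows "kraus_complete 1 (coin q)"
proof -
  have "complex_of_real (sqrt q) * complex_of_real (sqrt q)
      + complex_of_real (sqrt (1 - q)) * complex_of_real (sqrt (1 - q)) = complex_of_real (q + (1 - q))"
    using assms by (simp only: of_real_mult[symmetric] of_real_add[symmetric] real_sqrt_mult_self) simp
  then show ?thesis
    by (subst kraus_complete_iff) (auto simp: coin_def)
qed

lemma kraus_complete_ket_zeros: "kraus_complete 1 [ket_zeros 1]"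
  by (subst kraus_complete_iff) (auto simp: ket_zeros_def numeral_2_eq_2)

lemma kraus_complete_measurement: "kraus_complete d (measurement d)"
proof -
  have "(\<Sum>k\<leftarrow>[0..<d]. (if i = k then 1 else 0) * (if j = k then 1 else 0 :: complex))
      = (if i = j then 1 else 0)" if "i < d" for i j
  proof -
    have "(\<Sum>k\<leftarrow>[0..<d]. (if i = k then 1 else 0) * (if j = k then 1 else 0 :: complex))
      = (\<Sum>k<d. if i = k then (if j = k then 1 else 0) else 0)"
      unfolding interv_sum_list_conv_sum_set_nat set_upt atLeast0LessThan by (rule sum.cong) auto
    then show ?thesis using that by (simp add: sum.delta')
  qed
  then show ?thesis
    by (subst kraus_complete_iff)
      (auto simp: measurement_def comp_def if_distrib[of cnj] cong: map_cong if_cong)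
qed

section \<open>Exact outcome probabilities of the sampling algorithm\<close>

locale sampling =
  fixes n :: nat and \<psi> :: "complex vec" and B :: "real \<Rightarrow> real \<Rightarrow> real \<Rightarrow> complex mat"
    and q x s \<epsilon>' :: real and \<xi> :: "nat \<Rightarrow> real" and T :: nat and D :: "nat list \<Rightarrow> real \<times> bool"
  assumes state: "\<psi> \<in> carrier_vec (2 ^ n)" "vec_norm \<psi> = 1"
    and unitary: "t < T \<Longrightarrow> unitary_mat (2 ^ (n + 1)) (B (\<xi> t) s \<epsilon>')"
    and coin_bias: "0 \<le> q" "q \<le> 1"
begin

abbreviation alg :: algorithm where
  "alg \<equiv> sampling_algorithm n q x \<xi> s \<epsilon>' T D"

text \<open>The state of the ancilla in 0 next to a copy of \<open>\<psi>\<close>: the ancilla is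
  the most significant qubit, so \<open>\<psi>\<close> fills the first half of the
  amplitudes.\<close>

definition input :: "complex vec" where
  "input = vec (2 ^ (n + 1)) (\<lambda>i. if i < 2 ^ n then \<psi> $ i else 0)"

text \<open>Born's rule for a single round.\<close>

definition round_prob :: "nat \<Rightarrow> nat \<Rightarrow> real" where
  "round_prob t k = (cmod ((B (\<xi> t) s \<epsilon>' *\<^sub>v input) $ k))\<^sup>2"

lemma input_carrier [simp]: "input \<in> carrier_vec (2 ^ (n + 1))"
  and dim_input [simp]: "dim_vec input = 2 ^ (n + 1)"
  by (simp_all add: input_def)

lemma vec_norm_input: "vec_norm input = 1"
proof -
  have "(vec_norm input)\<^sup>2 = (\<Sum>i<2 ^ (n + 1). if i < 2 ^ n then (cmod (\<psi> $ i))\<^sup>2 else 0)"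
    unfolding power2_vec_norm by (auto simp: input_def intro!: sum.cong)
  also have "\<dots> = (\<Sum>i<2 ^ n. (cmod (\<psi> $ i))\<^sup>2)"
    by (rule sum.mono_neutral_cong_right) auto
  also have "\<dots> = (vec_norm \<psi>)\<^sup>2"
    unfolding power2_vec_norm using state by simp
  finally show ?thesis
    using state vec_norm_nonneg[of input] by (simp add: power2_eq_1_iff)
qed

lemma round_prob_nonneg: "0 \<le> round_prob t k"
  by (simp add: round_prob_def)

lemma B_carrier: "t < T \<Longrightarrow> B (\<xi> t) s \<epsilon>' \<in> carrier_mat (2 ^ (n + 1)) (2 ^ (n + 1))"
  using unitary by (simp add: unitary_mat_def)

lemma sum_round_prob:
  assumes "t < T"
  shows "(\<Sum>k<2 ^ (n + 1). round_prob t k) = 1"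
proof -
  have "(\<Sum>k<2 ^ (n + 1). round_prob t k) = (vec_norm (B (\<xi> t) s \<epsilon>' *\<^sub>v input))\<^sup>2"
    using B_carrier[OF assms] by (simp add: power2_vec_norm round_prob_def)
  also have "\<dots> = 1"
    using vec_norm_unitary[OF unitary[OF assms] input_carrier] by (simp add: vec_norm_input)
  finally show ?thesis .
qed

lemma kron_vec_ket_zero:
  "kron_vec (vec 2 (\<lambda>i. if i = 0 then z else 0)) \<psi> = z \<cdot>\<^sub>v input"
proof (rule eq_vecI)
  fix i assume "i < dim_vec (z \<cdot>\<^sub>v input)"
  then have i: "i < 2 * 2 ^ n" by simp
  then have "i div 2 ^ n < 2" by (simp add: less_mult_imp_div_less)
  moreover have "i div 2 ^ n = 0 \<longleftrightarrow> i < 2 ^ n" by (simp add: div_eq_0_iff)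
  ultimately show "kron_vec (vec 2 (\<lambda>i. if i = 0 then z else 0)) \<psi> $ i = (z \<cdot>\<^sub>v input) $ i"
    using i state by (auto simp: kron_vec_def input_def)
qed (use state in \<open>simp add: kron_vec_def\<close>)

lemma kron_mat_one_left: "kron_mat (1\<^sub>m 1) M = M"
  by (rule eq_matI) (auto simp: kron_mat_def)

text \<open>
  Since the measurement leaves no qubits, the workspace is a single amplitude after each round.
\<close>

lemma run_state_round:
  assumes t: "length ks < T" and nq: "num_qubits n alg (encode ks) = 0"
    and run: "run_state n \<psi> B alg (encode ks) = vec 1 (\<lambda>_. z)"
  shows "num_qubits n alg (0 # encode ks) = 1"
    and "num_qubits n alg (0 # 0 # encode ks) = n + 1"
    and "num_qubits n alg (0 # 0 # 0 # encode ks) = n + 1"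
    and "run_state n \<psi> B alg (0 # 0 # encode ks) = z \<cdot>\<^sub>v input"
    and "k < 2 ^ (n + 1) \<Longrightarrow> run_state n \<psi> B alg (encode (k # ks))
      = vec 1 (\<lambda>_. z * (B (\<xi> (length ks)) s \<epsilon>' *\<^sub>v input) $ k)"
proof -
  let ?B = "B (\<xi> (length ks)) s \<epsilon>'"
  show nq1: "num_qubits n alg (0 # encode ks) = 1"
    and nq2: "num_qubits n alg (0 # 0 # encode ks) = n + 1"
    and nq3: "num_qubits n alg (0 # 0 # 0 # encode ks) = n + 1"
    using t nq by simp_all
  have "run_state n \<psi> B alg (0 # encode ks) = ket_zeros 1 *\<^sub>v vec 1 (\<lambda>_. z)"
    using t run by simp
  also have "\<dots> = vec 2 (\<lambda>i. if i = 0 then z else 0)"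
    by (rule eq_vecI) (auto simp: ket_zeros_def scalar_prod_def)
  finally have "run_state n \<psi> B alg (0 # encode ks) = vec 2 (\<lambda>i. if i = 0 then z else 0)" .
  then show r2: "run_state n \<psi> B alg (0 # 0 # encode ks) = z \<cdot>\<^sub>v input"
    using t kron_vec_ket_zero by simp
  have Bc: "?B \<in> carrier_mat (2 ^ (n + 1)) (2 ^ (n + 1))"
    using B_carrier[OF t] .
  have "run_state n \<psi> B alg (0 # 0 # 0 # encode ks)
      = kron_mat (1\<^sub>m (2 ^ (num_qubits n alg (0 # 0 # encode ks) - (n + 1)))) ?B
        *\<^sub>v run_state n \<psi> B alg (0 # 0 # encode ks)"
    using t by (simp only: run_state.simps sampling_algorithm_simps action.case)
  then have r3: "run_state n \<psi> B alg (0 # 0 # 0 # encode ks) = z \<cdot>\<^sub>v (?B *\<^sub>v input)"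
    unfolding nq2 r2 diff_self_eq_0 power_0 kron_mat_one_left mult_mat_vec[OF Bc input_carrier] .
  assume k: "k < 2 ^ (n + 1)"
  have "run_state n \<psi> B alg (encode (k # ks))
      = (measurement (2 ^ (n + 1)) ! k) *\<^sub>v (z \<cdot>\<^sub>v (?B *\<^sub>v input))"
    using t by (simp only: encode.simps run_state.simps(2)[of _ _ _ _ k] sampling_algorithm_simps
        action.case r3)
  also have "\<dots> = vec 1 (\<lambda>_. z * (?B *\<^sub>v input) $ k)"
  proof (rule eq_vecI)
    fix i assume "i < dim_vec (vec 1 (\<lambda>_. z * (?B *\<^sub>v input) $ k))"
    then have i: "i = 0" by simp
    have nth: "measurement (2 ^ (n + 1)) ! k
        = mat 1 (2 ^ (n + 1)) (\<lambda>(i, j). if j = k then 1 else 0)"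
      using k by (simp add: measurement_def del: upt_Suc power_Suc)
    have "(measurement (2 ^ (n + 1)) ! k *\<^sub>v (z \<cdot>\<^sub>v (?B *\<^sub>v input))) $ 0
       = (\<Sum>j<2 ^ (n + 1). if j = k then z * (?B *\<^sub>v input) $ j else 0)"
      unfolding nth using Bc
      by (subst index_mult_mat_vec_sum) (auto simp: mult_delta_left simp del: index_mult_mat_vec)
    then show "(measurement (2 ^ (n + 1)) ! k *\<^sub>v (z \<cdot>\<^sub>v (?B *\<^sub>v input))) $ i
        = vec 1 (\<lambda>_. z * (?B *\<^sub>v input) $ k) $ i"
      using k i by (simp del: index_mult_mat_vec)
  qed (use k in \<open>simp add: measurement_def del: upt_Suc power_Suc\<close>)
  finally show "run_state n \<psi> B alg (encode (k # ks)) = vec 1 (\<lambda>_. z * (?B *\<^sub>v input) $ k)" .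
qed

text \<open>Only the modulus of the amplitude matters. The coin contributes \<open>1 - q\<close> and
  every round multiplies by its Born probability; the rounds are independent because no qubit
  survives a round.\<close>

lemma run_state_encode:
  assumes "set ks \<subseteq> {..<2 ^ (n + 1)}" "length ks \<le> T"
  shows "num_qubits n alg (encode ks) = 0 \<and>
    (\<exists>z. run_state n \<psi> B alg (encode ks) = vec 1 (\<lambda>_. z) \<and>
      (cmod z)\<^sup>2 = (1 - q) * weight round_prob ks)"
  using assms
proof (induction ks)
  case Nil
  have "complex_of_real (sqrt (1 - q)) \<cdot>\<^sub>m 1\<^sub>m 1 *\<^sub>v vec 1 (\<lambda>_. 1)
      = vec 1 (\<lambda>_. complex_of_real (sqrt (1 - q)))"
    by (rule eq_vecI) (auto simp: scalar_prod_def)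
  moreover have "(cmod (complex_of_real (sqrt (1 - q))))\<^sup>2 = 1 - q"
    using coin_bias by simp
  ultimately show ?case
    by (auto simp: coin_def simp del: norm_of_real)
next
  case (Cons k ks)
  then obtain z where t: "length ks < T" and k: "k < 2 ^ (n + 1)"
    and nq: "num_qubits n alg (encode ks) = 0"
    and run: "run_state n \<psi> B alg (encode ks) = vec 1 (\<lambda>_. z)"
    and z: "(cmod z)\<^sup>2 = (1 - q) * weight round_prob ks"
    by auto
  have "num_qubits n alg (encode (k # ks)) = 0"
    using t by simp
  moreover have "(cmod (z * (B (\<xi> (length ks)) s \<epsilon>' *\<^sub>v input) $ k))\<^sup>2
      = (1 - q) * weight round_prob (k # ks)"
    by (simp add: norm_mult power_mult_distrib z round_prob_def del: index_mult_mat_vec)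
  ultimately show ?case
    using run_state_round(5)[OF t nq run k] by blast
qed

lemma history_prob_encode:
  assumes "set ks \<subseteq> {..<2 ^ (n + 1)}" "length ks \<le> T"
  shows "history_prob n \<psi> B alg (encode ks) = ennreal ((1 - q) * weight round_prob ks)"
  using run_state_encode[OF assms] by (auto simp: history_prob_def power2_vec_norm)

text \<open>Appending the ancilla and the copy of \<open>\<psi>\<close> preserves the norm, so the
  history just before a query has the probability of its completed rounds.\<close>

lemma history_prob_query:
  assumes "set ks \<subseteq> {..<2 ^ (n + 1)}" "length ks < T"
  shows "history_prob n \<psi> B alg (0 # 0 # encode ks) = ennreal ((1 - q) * weight round_prob ks)"
proof -
  obtain z where nq: "num_qubits n alg (encode ks) = 0"
    and run: "run_state n \<psi> B alg (encode ks) = vec 1 (\<lambda>_. z)"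
    and z: "(cmod z)\<^sup>2 = (1 - q) * weight round_prob ks"
    using run_state_encode[of ks] assms by auto
  have "(vec_norm (z \<cdot>\<^sub>v input))\<^sup>2 = (cmod z)\<^sup>2 * (vec_norm input)\<^sup>2"
    by (simp add: power2_vec_norm norm_mult power_mult_distrib sum_distrib_left)
  then show ?thesis
    unfolding history_prob_def run_state_round(4)[OF assms(2) nq run] z vec_norm_input by simp
qed

lemma history_prob_coin: "history_prob n \<psi> B alg [0] = ennreal q"
proof -
  have "run_state n \<psi> B alg [0] = vec 1 (\<lambda>_. complex_of_real (sqrt q))"
    by (rule eq_vecI) (auto simp: coin_def scalar_prod_def)
  then show ?thesis
    using coin_bias by (simp add: history_prob_def power2_vec_norm del: run_state.simps)
qed

lemma valid_sampling_algorithm: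
  assumes "\<And>t. t < T \<Longrightarrow> 0 \<le> \<xi> t \<and> \<xi> t \<le> pi" "s_lo \<le> s" "s \<le> s_hi" "0 < \<epsilon>'" "\<epsilon>' < 1"
  shows "valid_algorithm n s_lo s_hi alg"
  unfolding valid_algorithm_def
proof (intro allI impI)
  fix h assume "reachable alg h"
  then consider "h = []" | "h = [0]"
    | ks where "set ks \<subseteq> {..<2 ^ (n + 1)}" "length ks \<le> T" "h = encode ks"
    | ks where "set ks \<subseteq> {..<2 ^ (n + 1)}" "length ks < T" "h = 0 # encode ks"
    | ks where "set ks \<subseteq> {..<2 ^ (n + 1)}" "length ks < T" "h = 0 # 0 # encode ks"
    | ks where "set ks \<subseteq> {..<2 ^ (n + 1)}" "length ks < T" "h = 0 # 0 # 0 # encode ks"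
    unfolding reachable_sampling_algorithm by blast
  then show "case alg h of
           Halt x a \<Rightarrow> True
         | Prepare \<Rightarrow> True
         | Instrument q Ks \<Rightarrow>
             set Ks \<subseteq> carrier_mat (2 ^ q) (2 ^ num_qubits n alg h) \<and>
             kraus_complete (2 ^ num_qubits n alg h) Ks
         | Query \<xi> s \<epsilon>' \<Rightarrow>
             n + 1 \<le> num_qubits n alg h \<and> 0 \<le> \<xi> \<and> \<xi> \<le> pi \<and> s_lo \<le> s \<and> s \<le> s_hi \<and> 0 < \<epsilon>' \<and> \<epsilon>' < 1"
  proof cases
    case 1
    then show ?thesis
      using kraus_complete_coin coin_bias by (simp add: coin_def)
  next
    case 2
    then show ?thesis by simp
  next
    case (3 ks)
    then have "num_qubits n alg h = 0"
      using run_state_encode[of ks] by simp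
    then show ?thesis
      using 3 kraus_complete_ket_zeros
      by (cases "length ks < T") (simp_all add: ket_zeros_def)
  next
    case (4 ks)
    then show ?thesis by simp
  next
    case (5 ks)
    then have "num_qubits n alg h = n + 1"
      using run_state_round(2)[of ks] run_state_encode[of ks] by auto
    then show ?thesis
      using 5 assms by simp
  next
    case (6 ks)
    then have nq: "num_qubits n alg h = n + 1"
      using run_state_round(3)[of ks] run_state_encode[of ks] by auto
    have "set (measurement (2 ^ (n + 1))) \<subseteq> carrier_mat (2 ^ 0) (2 ^ (n + 1))"
      by (auto simp: measurement_def)
    then show ?thesis
      unfolding nq using 6 kraus_complete_measurement
      by (simp only: sampling_algorithm_simps action.case)
  qed
qed

text \<open>The algorithm halts only after coin outcome 0 or after \<open>T\<close> complete rounds.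
  These are finitely many histories, and they are told apart by the coin outcome at the end of the
  list.\<close>

lemma output_prob_sampling_algorithm:
  "output_prob n \<psi> B alg P = ennreal (q * of_bool (P x False)
     + (1 - q) * (\<Sum>ks\<in>{ks \<in> outcomes (2 ^ (n + 1)) T. P (fst (D ks)) (snd (D ks))}. weight round_prob ks))"
proof -
  let ?G = "{ks \<in> outcomes (2 ^ (n + 1)) T. P (fst (D ks)) (snd (D ks))}"
  let ?C = "if P x False then {[0]} else {} :: nat list set"
  have halt: "(\<exists>y a. alg (encode ks) = Halt y a \<and> P y a)
      \<longleftrightarrow> T \<le> length ks \<and> P (fst (D ks)) (snd (D ks))" for ks
    by (cases "T \<le> length ks") auto
  have "{h. reachable alg h \<and> (\<exists>y a. alg h = Halt y a \<and> P y a)} = ?C \<union> encode ` ?G"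
  proof (rule Set.set_eqI)
    fix h
    show "h \<in> {h. reachable alg h \<and> (\<exists>y a. alg h = Halt y a \<and> P y a)} \<longleftrightarrow> h \<in> ?C \<union> encode ` ?G"
      (is "?l \<longleftrightarrow> ?r")
    proof
      assume ?l
      then have "reachable alg h" and hh: "\<exists>y a. alg h = Halt y a \<and> P y a" by simp_all
      then consider "h = []" | "h = [0]"
        | ks where "set ks \<subseteq> {..<2 ^ (n + 1)}" "length ks \<le> T" "h = encode ks"
        | ks where "length ks < T" "h \<in> {0 # encode ks, 0 # 0 # encode ks, 0 # 0 # 0 # encode ks}"
        unfolding reachable_sampling_algorithm by blast
      then show ?r
      proof cases
        case (3 ks)
        then have "ks \<in> ?G"
          using hh halt[of ks] by (auto simp: outcomes_def)
        then show ?thesis using 3 by blast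
      qed (use hh in auto)
    next
      assume ?r
      then consider "h = [0]" "P x False" | ks where "ks \<in> ?G" "h = encode ks"
        by (auto split: if_splits)
      then show ?l
      proof cases
        case 1
        then show ?thesis unfolding reachable_sampling_algorithm by (auto intro: exI[of _ False])
      next
        case (2 ks)
        then have "set ks \<subseteq> {..<2 ^ (n + 1)}" "length ks = T" "P (fst (D ks)) (snd (D ks))"
          by (auto simp: outcomes_def)
        then show ?thesis
          unfolding reachable_sampling_algorithm using 2 halt[of ks] by blast
      qed
    qed
  qed
  then have "output_prob n \<psi> B alg P = (\<Sum>h\<in>?C \<union> encode ` ?G. history_prob n \<psi> B alg h)"
    unfolding output_prob_def by (simp add: infsum_finite)
  also have "\<dots> = (\<Sum>h\<in>?C. history_prob n \<psi> B alg h) + (\<Sum>h\<in>encode ` ?G. history_prob n \<psi> B alg h)"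
  proof (rule sum.union_disjoint)
    have "[0] \<noteq> encode ks" for ks by (metis last_encode last.simps zero_neq_one)
    then show "?C \<inter> encode ` ?G = {}" by auto
  qed auto
  also have "(\<Sum>h\<in>?C. history_prob n \<psi> B alg h) = ennreal (q * of_bool (P x False))"
    by (simp add: history_prob_coin)
  also have "(\<Sum>h\<in>encode ` ?G. history_prob n \<psi> B alg h)
      = (\<Sum>ks\<in>?G. ennreal ((1 - q) * weight round_prob ks))"
    by (subst sum.reindex) (auto simp: inj_on_subset[OF inj_encode] outcomes_def
        history_prob_encode intro!: sum.cong)
  also have "\<dots> = ennreal ((1 - q) * (\<Sum>ks\<in>?G. weight round_prob ks))"
    using coin_bias by (simp add: sum_distrib_left weight_nonneg round_prob_nonneg)
  finally show ?thesis
    using coin_bias by (simp add: ennreal_plus sum_nonneg weight_nonneg round_prob_nonneg)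
qed

text \<open>Unless the coin stops the run, every round makes exactly one query; the outcome lists of
  each fixed length below \<open>T\<close> have total weight 1.\<close>

lemma expected_queries_sampling_algorithm:
  "expected_queries n \<psi> B alg = ennreal (T * (1 - q))"
proof -
  let ?G = "\<Union>t<T. outcomes (2 ^ (n + 1)) t"
  let ?f = "\<lambda>ks. 0 # 0 # encode ks"
  have "{h. reachable alg h \<and> (\<exists>\<xi> s \<epsilon>'. alg h = Query \<xi> s \<epsilon>')} = ?f ` ?G"
  proof (rule Set.set_eqI)
    fix h
    show "h \<in> {h. reachable alg h \<and> (\<exists>\<xi> s \<epsilon>'. alg h = Query \<xi> s \<epsilon>')} \<longleftrightarrow> h \<in> ?f ` ?G"
      (is "?l \<longleftrightarrow> ?r")
    proof
      assume ?l
      then have "reachable alg h" and hh: "\<exists>\<xi> s \<epsilon>'. alg h = Query \<xi> s \<epsilon>'" by simp_all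
      then consider "h = []" | "h = [0]"
        | ks where "h = encode ks"
        | ks where "set ks \<subseteq> {..<2 ^ (n + 1)}" "length ks < T"
           "h \<in> {0 # encode ks, 0 # 0 # encode ks, 0 # 0 # 0 # encode ks}"
        unfolding reachable_sampling_algorithm by blast
      then show ?r
      proof cases
        case (3 ks)
        then show ?thesis using hh by (cases "length ks < T") auto
      next
        case (4 ks)
        then have "h = ?f ks" using hh by auto
        moreover have "ks \<in> ?G" using 4 by (auto simp: outcomes_def)
        ultimately show ?thesis by blast
      qed (use hh in auto)
    next
      assume ?r
      then obtain ks where ks: "set ks \<subseteq> {..<2 ^ (n + 1)}" "length ks < T" "h = ?f ks"
        by (auto simp: outcomes_def)
      then have "reachable alg h"
        unfolding reachable_sampling_algorithm by blast
      then show ?l using ks by simp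
    qed
  qed
  then have "expected_queries n \<psi> B alg = (\<Sum>h\<in>?f ` ?G. history_prob n \<psi> B alg h)"
    unfolding expected_queries_def by (simp add: infsum_finite)
  also have "\<dots> = (\<Sum>ks\<in>?G. ennreal ((1 - q) * weight round_prob ks))"
  proof (subst sum.reindex)
    show "inj_on ?f ?G"
      using inj_encode by (auto simp: inj_on_def)
    show "sum (history_prob n \<psi> B alg \<circ> ?f) ?G
        = (\<Sum>ks\<in>?G. ennreal ((1 - q) * weight round_prob ks))"
      by (intro sum.cong refl) (auto simp: outcomes_def history_prob_query)
  qed
  also have "\<dots> = ennreal ((1 - q) * (\<Sum>ks\<in>?G. weight round_prob ks))"
    using coin_bias by (simp add: sum_distrib_left weight_nonneg round_prob_nonneg)
  also have "(\<Sum>ks\<in>?G. weight round_prob ks) = (\<Sum>t<T. \<Sum>ks\<in>outcomes (2 ^ (n + 1)) t. weight round_prob ks)"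
    by (rule sum.UNION_disjoint) (auto simp: outcomes_def finite_lists_length_eq)
  also have "\<dots> = T"
    using sum_weight[OF sum_round_prob] by (simp add: less_imp_le)
  finally show ?thesis
    by (simp add: mult.commute)
qed

end

section \<open>Success probability under approximate block-encodings\<close>

context sampling
begin

text \<open>The right Kronecker factor inserts the ancilla in state 0, and the left one selects the
  first half of the amplitudes.\<close>

lemma block_of_ket_zeros:
  assumes U: "U \<in> carrier_mat (2 ^ (n + 1)) (2 ^ (n + 1))"
  shows "(kron_mat (mat_adjoint (ket_zeros 1)) (1\<^sub>m (2 ^ n)) * U * kron_mat (ket_zeros 1) (1\<^sub>m (2 ^ n))) *\<^sub>v \<psi>
    = vec (2 ^ n) (\<lambda>k. (U *\<^sub>v input) $ k)"
proof -
  let ?X = "kron_mat (mat_adjoint (ket_zeros 1)) (1\<^sub>m (2 ^ n))"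
  let ?Y = "kron_mat (ket_zeros 1) (1\<^sub>m (2 ^ n))"
  have X: "?X \<in> carrier_mat (2 ^ n) (2 ^ (n + 1))" and Y: "?Y \<in> carrier_mat (2 ^ (n + 1)) (2 ^ n)"
    by (simp_all add: kron_mat_def ket_zeros_def)
  have div: "i div 2 ^ n < 2" "i div 2 ^ n = 0 \<longleftrightarrow> i < 2 ^ n" if "i < 2 * 2 ^ n" for i :: nat
    using that by (simp_all add: less_mult_imp_div_less div_eq_0_iff)
  have "?Y *\<^sub>v \<psi> = input"
  proof (rule eq_vecI)
    fix i assume "i < dim_vec input"
    then have i: "i < 2 * 2 ^ n" by simp
    have "(?Y *\<^sub>v \<psi>) $ i = (\<Sum>k<2 ^ n. ?Y $$ (i, k) * \<psi> $ k)"
      using i Y state by (subst index_mult_mat_vec_sum) auto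
    also have "\<dots> = (\<Sum>k<2 ^ n. if k = i then \<psi> $ k else 0)"
    proof (intro sum.cong refl)
      fix k :: nat assume "k \<in> {..<2 ^ n}"
      then show "?Y $$ (i, k) * \<psi> $ k = (if k = i then \<psi> $ k else 0)"
        using i div[OF i] by (auto simp: kron_mat_def ket_zeros_def)
    qed
    also have "\<dots> = input $ i"
      using i by (simp add: input_def)
    finally show "(?Y *\<^sub>v \<psi>) $ i = input $ i" .
  qed (use Y in simp)
  moreover have "?X *\<^sub>v w = vec (2 ^ n) (\<lambda>k. w $ k)" if w: "w \<in> carrier_vec (2 ^ (n + 1))" for w
  proof (rule eq_vecI)
    fix i assume "i < dim_vec (vec (2 ^ n) (\<lambda>k. w $ k))"
    then have i: "i < 2 ^ n" by simp
    have "(?X *\<^sub>v w) $ i = (\<Sum>k<2 ^ (n + 1). ?X $$ (i, k) * w $ k)"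
      using i X w by (subst index_mult_mat_vec_sum) auto
    also have "\<dots> = (\<Sum>k<2 ^ (n + 1). if k = i then w $ k else 0)"
    proof (intro sum.cong refl)
      fix k :: nat assume "k \<in> {..<2 ^ (n + 1)}"
      then have k: "k < 2 * 2 ^ n" by simp
      then show "?X $$ (i, k) * w $ k = (if k = i then w $ k else 0)"
        using i div[OF k]
        by (auto simp: kron_mat_def ket_zeros_def index_mat_adjoint mod_less_divisor)
    qed
    finally show "(?X *\<^sub>v w) $ i = vec (2 ^ n) (\<lambda>k. w $ k) $ i"
      using i by simp
  qed (use X in simp)
  moreover have "(?X * U * ?Y) *\<^sub>v \<psi> = ?X *\<^sub>v (U *\<^sub>v (?Y *\<^sub>v \<psi>))"
    using assoc_mult_mat_vec[OF mult_carrier_mat[OF X U] Y state(1)]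
      assoc_mult_mat_vec[OF X U mult_mat_vec_carrier[OF Y state(1)]] by metis
  ultimately show ?thesis
    using mult_mat_vec_carrier[OF U input_carrier] by metis
qed

text \<open>The two vectors have norms differing by at most \<open>\<epsilon>'\<close>, by the
  reverse triangle inequality. Both norms are at most 1, so factoring the difference of squares
  costs a further factor 2.\<close>

lemma round_prob_block_encoding:
  assumes "t < T" and be: "block_encoding n G 1 1 \<epsilon>' (B (\<xi> t) s \<epsilon>')" and G1: "vec_norm (G *\<^sub>v \<psi>) \<le> 1"
  shows "\<bar>(\<Sum>k<2 ^ n. round_prob t k) - (vec_norm (G *\<^sub>v \<psi>))\<^sup>2\<bar> \<le> 2 * \<epsilon>'"
proof -
  define R where "R = kron_mat (mat_adjoint (ket_zeros 1)) (1\<^sub>m (2 ^ n)) * B (\<xi> t) s \<epsilon>'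
    * kron_mat (ket_zeros 1) (1\<^sub>m (2 ^ n))"
  have R: "R \<in> carrier_mat (2 ^ n) (2 ^ n)"
    by (rule carrier_matI) (simp_all add: R_def kron_mat_def ket_zeros_def)
  have "complex_of_real 1 \<cdot>\<^sub>m R = R"
    by (rule eq_matI) auto
  then have G: "G \<in> carrier_mat (2 ^ n) (2 ^ n)" and op: "op_norm (G - R) \<le> \<epsilon>'"
    using be unfolding block_encoding_def R_def by auto
  have R\<psi>: "R *\<^sub>v \<psi> = vec (2 ^ n) (\<lambda>k. (B (\<xi> t) s \<epsilon>' *\<^sub>v input) $ k)"
    unfolding R_def by (rule block_of_ket_zeros[OF B_carrier[OF \<open>t < T\<close>]])
  have sq: "(\<Sum>k<2 ^ n. round_prob t k) = (vec_norm (R *\<^sub>v \<psi>))\<^sup>2"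
    unfolding R\<psi> power2_vec_norm by (simp add: round_prob_def)
  have "(\<Sum>k<2 ^ n. round_prob t k) \<le> (\<Sum>k<2 ^ (n + 1). round_prob t k)"
    by (rule sum_mono2) (auto simp: round_prob_nonneg)
  then have R1: "vec_norm (R *\<^sub>v \<psi>) \<le> 1"
    unfolding sum_round_prob[OF \<open>t < T\<close>] sq by (simp add: power_le_one_iff vec_norm_nonneg)
  have "vec_norm ((G - R) *\<^sub>v \<psi>) \<le> op_norm (G - R)"
    by (rule vec_norm_mult_le_op_norm) (use R state in auto)
  also have "(G - R) *\<^sub>v \<psi> = G *\<^sub>v \<psi> - R *\<^sub>v \<psi>"
    by (rule minus_mult_distrib_mat_vec[OF G R state(1)])
  finally have "\<bar>vec_norm (G *\<^sub>v \<psi>) - vec_norm (R *\<^sub>v \<psi>)\<bar> \<le> \<epsilon>'"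
    using vec_norm_reverse_triangle[OF mult_mat_vec_carrier[OF G state(1)] mult_mat_vec_carrier[OF R state(1)]]
      op by linarith
  then have "\<bar>vec_norm (R *\<^sub>v \<psi>) - vec_norm (G *\<^sub>v \<psi>)\<bar> * (vec_norm (R *\<^sub>v \<psi>) + vec_norm (G *\<^sub>v \<psi>))
      \<le> \<epsilon>' * 2"
    using R1 G1 by (intro mult_mono) (auto intro: add_nonneg_nonneg vec_norm_nonneg)
  moreover have "(vec_norm (R *\<^sub>v \<psi>))\<^sup>2 - (vec_norm (G *\<^sub>v \<psi>))\<^sup>2
      = (vec_norm (R *\<^sub>v \<psi>) - vec_norm (G *\<^sub>v \<psi>)) * (vec_norm (R *\<^sub>v \<psi>) + vec_norm (G *\<^sub>v \<psi>))"
    by (simp add: power2_eq_square algebra_simps)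
  ultimately show ?thesis
    unfolding sq by (simp add: abs_mult vec_norm_nonneg)
qed

end

section \<open>Second moments from Gaussian averages\<close>

text \<open>Among \<open>3 * m\<close> rounds, the residue class \<open>i\<close> modulo 3 contains
  the \<open>m\<close> rounds run with the \<open>i\<close>-th shift. An outcome below
  \<open>d\<close> is a success; \<open>d = 2 ^ n\<close> will mean that the ancilla is found in
  state 0.\<close>

definition estimate :: "nat \<Rightarrow> nat \<Rightarrow> nat list \<Rightarrow> nat \<Rightarrow> real" where
  "estimate d m ks i = score (\<lambda>t k. of_bool (t mod 3 = i \<and> k < d)) ks / m"

lemma score_diff_const:
  "score (\<lambda>t k. f t k - g t) ks = score f ks - (\<Sum>t<length ks. g t)"
  by (induction ks) auto

lemma sum_mod_3:
  fixes i m :: nat and c :: real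
  assumes "i < 3"
  shows "(\<Sum>t<3 * m. of_bool (t mod 3 = i) * c) = m * c"
proof (induction m)
  case (Suc m)
  have "3 * Suc m = Suc (Suc (Suc (3 * m)))" by simp
  moreover have "i = 0 \<or> i = 1 \<or> i = 2" using assms by linarith
  moreover have "Suc (3 * m) mod 3 = 1" "Suc (Suc (3 * m)) mod 3 = 2" by presburger+
  ultimately show ?case
    unfolding \<open>3 * Suc m = _\<close> sum.lessThan_Suc Suc by (auto simp: algebra_simps)
qed simp

text \<open>Half of the tolerance \<open>\<tau>\<close> absorbs the bias caused by inexact
  block-encodings; the other half is left to statistical fluctuation. Rounds of other residue
  classes have increment zero, so all \<open>3 * m\<close> rounds can be fed to
  \<open>chernoff_bound\<close>.\<close>

lemma estimate_failure:
  assumes p: "\<And>t k. 0 \<le> p t k" and p1: "\<And>t. t < 3 * m \<Longrightarrow> (\<Sum>k<K. p t k) = 1"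
    and d: "d \<le> K" and m: "0 < m" and \<tau>: "0 < \<tau>" "\<tau> \<le> 1" and i: "i < 3"
    and P: "\<And>t. t < 3 * m \<Longrightarrow> \<bar>(\<Sum>k<d. p t k) - P (t mod 3)\<bar> \<le> \<tau> / 2"
  shows "(\<Sum>ks\<in>{ks \<in> outcomes K (3 * m). \<tau> \<le> \<bar>estimate d m ks i - P i\<bar>}. weight p ks)
    \<le> 2 * exp (- (m * \<tau>\<^sup>2 / 48))"
proof -
  \<comment> \<open>The mean of the indicator in round \<open>t\<close>; subtracting it centres
    \<open>X\<close>.\<close>
  define g where "g t = of_bool (t mod 3 = i) * (\<Sum>k<d. p t k)" for t
  define X where "X t k = of_bool (t mod 3 = i \<and> k < d) - g t" for t k
  have le1: "(\<Sum>k<d. p t k) \<le> 1" if "t < 3 * m" for t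
    unfolding p1[OF that, symmetric] by (rule sum_mono2) (use d p in auto)
  have X1: "\<bar>X t k\<bar> \<le> 1" if "t < 3 * m" for t k
    using le1[OF that] sum_nonneg[of "{..<d}" "p t"] p by (auto simp: X_def g_def abs_le_iff)
  have mean: "(\<Sum>k<K. p t k * X t k) = 0" if "t < 3 * m" for t
  proof (cases "t mod 3 = i")
    case True
    have "(\<Sum>k<K. p t k * of_bool (k < d)) = (\<Sum>k<d. p t k)"
      using d by (intro sum.mono_neutral_cong_right) auto
    then show ?thesis
      using True p1[OF that]
      by (simp add: X_def g_def right_diff_distrib sum_subtractf sum_distrib_right[symmetric])
  qed (simp add: X_def g_def)
  have "(\<Sum>ks\<in>{ks \<in> outcomes K (3 * m). \<tau> \<le> \<bar>estimate d m ks i - P i\<bar>}. weight p ks)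
     \<le> (\<Sum>ks\<in>{ks \<in> outcomes K (3 * m). m * \<tau> / 2 \<le> \<bar>score X ks\<bar>}. weight p ks)"
  proof (rule sum_mono2)
    show "{ks \<in> outcomes K (3 * m). \<tau> \<le> \<bar>estimate d m ks i - P i\<bar>}
       \<subseteq> {ks \<in> outcomes K (3 * m). m * \<tau> / 2 \<le> \<bar>score X ks\<bar>}"
    proof (intro subsetI CollectI conjI)
      fix ks assume "ks \<in> {ks \<in> outcomes K (3 * m). \<tau> \<le> \<bar>estimate d m ks i - P i\<bar>}"
      then have ks: "ks \<in> outcomes K (3 * m)" and dev: "\<tau> \<le> \<bar>estimate d m ks i - P i\<bar>" by auto
      show "ks \<in> outcomes K (3 * m)" by (rule ks)
      define S where "S = score (\<lambda>t k. of_bool (t mod 3 = i \<and> k < d)) ks"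
      have "m * (estimate d m ks i - P i) = S - m * P i"
        using m by (simp add: estimate_def S_def right_diff_distrib)
      moreover have "m * \<tau> \<le> \<bar>m * (estimate d m ks i - P i)\<bar>"
        using dev by (simp add: abs_mult mult_left_mono)
      ultimately have "m * \<tau> \<le> \<bar>S - m * P i\<bar>" by simp
      moreover have "score X ks = S - (\<Sum>t<3 * m. g t)"
        unfolding X_def score_diff_const S_def using ks by (simp add: outcomes_def)
      moreover have "\<bar>(\<Sum>t<3 * m. g t) - m * P i\<bar> \<le> m * \<tau> / 2"
      proof -
        have "(\<Sum>t<3 * m. g t) - m * P i = (\<Sum>t<3 * m. g t - of_bool (t mod 3 = i) * P i)"
          by (simp add: sum_subtractf sum_mod_3[OF i])
        also have "\<bar>\<dots>\<bar> \<le> (\<Sum>t<3 * m. of_bool (t mod 3 = i) * (\<tau> / 2))"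
          by (intro order.trans[OF sum_abs] sum_mono) (use P in \<open>auto simp: g_def\<close>)
        finally show ?thesis
          by (simp only: sum_mod_3[OF i])
      qed
      ultimately show "m * \<tau> / 2 \<le> \<bar>score X ks\<bar>" by linarith
    qed
  qed (auto simp: weight_nonneg p)
  \<comment> \<open>The choice \<open>l = \<tau> / 12\<close> minimises
    \<open>l\<^sup>2 * (3 * m) - l * (m * \<tau> / 2)\<close>.\<close>
  also have "\<dots> \<le> 2 * exp ((\<tau> / 12)\<^sup>2 * (3 * m) - \<tau> / 12 * (m * \<tau> / 2))"
    using chernoff_bound[of p "3 * m" K X "\<tau> / 12" "m * \<tau> / 2"] p p1 mean X1 \<tau> by simp
  also have "(\<tau> / 12)\<^sup>2 * (3 * m) - \<tau> / 12 * (m * \<tau> / 2) = - (m * \<tau>\<^sup>2 / 48)"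
    by (simp add: power2_eq_square)
  finally show ?thesis .
qed

text \<open>
  With \<open>u = (E - \<xi>) / \<sigma>\<close>, the Gaussian shifted by \<open>d * i * \<sigma>\<close>, where \<open>d\<close> is a sign, equals
  \<open>exp (- u\<^sup>2)\<close> times the \<open>i\<close>-th power of \<open>exp (2 * d * u)\<close>, up to the factor \<open>exp (- i\<^sup>2)\<close>.  Hence
  three shifts give the second moment of \<open>exp (2 * d * u)\<close> about \<open>y\<close>.
\<close>

definition second_moment :: "(nat \<Rightarrow> real) \<Rightarrow> real \<Rightarrow> real" where
  "second_moment P y = exp 4 * P 2 - 2 * y * (exp 1 * P 1) + y\<^sup>2 * P 0"

lemma second_moment_gaussians:
  fixes w P :: "nat \<Rightarrow> real"
  assumes P: "\<And>i. i < 3 \<Longrightarrow> P i = (\<Sum>j<N. w j * exp (- ((E j - (\<xi> + d * i * \<sigma>)) / \<sigma>)\<^sup>2))"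
    and d: "d\<^sup>2 = 1" and \<sigma>: "0 < \<sigma>"
  shows "second_moment P y
    = (\<Sum>j<N. w j * exp (- ((E j - \<xi>) / \<sigma>)\<^sup>2) * (exp (2 * d * ((E j - \<xi>) / \<sigma>)) - y)\<^sup>2)"
proof -
  define u where "u j = (E j - \<xi>) / \<sigma>" for j
  have sh: "(E j - (\<xi> + d * i * \<sigma>)) / \<sigma> = u j - d * i" for j and i :: real
    using \<sigma> by (simp add: u_def field_simps)
  have P': "P i = (\<Sum>j<N. w j * exp (- (u j - d * i)\<^sup>2))" if "i < 3" for i
    using P[OF that] sh by simp
  \<comment> \<open>Completing the square; the coefficient of \<open>i\<^sup>2\<close> is right
    because \<open>d\<^sup>2 = 1\<close>.\<close>
  have exp_sh: "exp (- (u j)\<^sup>2) * exp (2 * d * u j * i) = exp (i\<^sup>2) * exp (- (u j - d * i)\<^sup>2)" for j i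
    using d by (simp add: exp_add[symmetric] power2_eq_square algebra_simps)
  have 1: "exp (- (u j)\<^sup>2) * exp (2 * d * u j) = exp 1 * exp (- (u j - d)\<^sup>2)"
    and 2: "exp (- (u j)\<^sup>2) * (exp (2 * d * u j))\<^sup>2 = exp 4 * exp (- (u j - d * 2)\<^sup>2)" for j
    using exp_sh[of j 1] exp_sh[of j 2] by (simp_all add: exp_double[symmetric] mult.commute)
  have "w j * exp (- (u j)\<^sup>2) * (exp (2 * d * u j) - y)\<^sup>2
     = exp 4 * (w j * exp (- (u j - d * 2)\<^sup>2)) - 2 * y * (exp 1 * (w j * exp (- (u j - d)\<^sup>2)))
       + y\<^sup>2 * (w j * exp (- (u j)\<^sup>2))" for j
  proof -
    have "w j * exp (- (u j)\<^sup>2) * (exp (2 * d * u j) - y)\<^sup>2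
      = w j * (exp (- (u j)\<^sup>2) * (exp (2 * d * u j))\<^sup>2) - 2 * y * (w j * (exp (- (u j)\<^sup>2) * exp (2 * d * u j)))
        + y\<^sup>2 * (w j * exp (- (u j)\<^sup>2))"
      by (simp add: power2_diff algebra_simps)
    then show ?thesis
      unfolding 1 2 by (simp add: mult_ac)
  qed
  then show ?thesis
    unfolding u_def[symmetric] second_moment_def
    by (simp add: P' sum.distrib sum_subtractf sum_distrib_left)
qed

text \<open>For \<open>y \<le> exp 2\<close> the coefficients of the three probabilities have
  absolute values at most \<open>exp 4\<close>, \<open>2 * exp 4\<close> and
  \<open>exp 4\<close>.\<close>

lemma second_moment_perturbation:
  assumes P: "\<And>i. i < 3 \<Longrightarrow> \<bar>P' i - P i\<bar> \<le> \<tau>" and y: "0 \<le> y" "y \<le> exp 2"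
  shows "\<bar>second_moment P' y - second_moment P y\<bar> \<le> 4 * exp 4 * \<tau>"
proof -
  have "0 \<le> \<tau>" using P[of 0] by linarith
  have "y * exp 1 \<le> exp 2 * exp (1 :: real)"
    using y by simp
  also have "\<dots> \<le> exp 4" by (simp flip: exp_add)
  finally have y1: "y * exp 1 \<le> exp 4" .
  have "y\<^sup>2 \<le> (exp 2)\<^sup>2" using y by (intro power_mono) auto
  then have y2: "y\<^sup>2 \<le> exp 4" by (simp flip: exp_double)
  have "\<bar>exp 4 * (P' 2 - P 2)\<bar> \<le> exp 4 * \<tau>"
    using P[of 2] by (simp add: abs_mult)
  moreover have "\<bar>(y * exp 1) * (P' 1 - P 1)\<bar> \<le> exp 4 * \<tau>"
    unfolding abs_mult[of "y * exp 1"] using P[of 1] y y1 \<open>0 \<le> \<tau>\<close> by (intro mult_mono) auto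
  moreover have "\<bar>y\<^sup>2 * (P' 0 - P 0)\<bar> \<le> exp 4 * \<tau>"
    unfolding abs_mult[of "y\<^sup>2"] using P[of 0] y2 \<open>0 \<le> \<tau>\<close> by (intro mult_mono) auto
  moreover have "second_moment P' y - second_moment P y
      = exp 4 * (P' 2 - P 2) - 2 * ((y * exp 1) * (P' 1 - P 1)) + y\<^sup>2 * (P' 0 - P 0)"
    by (simp add: second_moment_def algebra_simps)
  ultimately show ?thesis by linarith
qed

text \<open>The derivative of \<open>ln\<close> is at most \<open>exp 2\<close> on this range. The
  range is the natural one, as \<open>exp (2 * d * u)\<close> is at least \<open>exp (- 2)\<close>
  whenever \<open>u\<close> has absolute value at most 1.\<close>

lemma abs_ln_diff_le:
  fixes x y :: real
  assumes "exp (- 2) \<le> x" "exp (- 2) \<le> y"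
  shows "\<bar>ln y - ln x\<bar> \<le> exp 2 * \<bar>y - x\<bar>"
proof -
  have *: "ln b - ln a \<le> exp 2 * \<bar>b - a\<bar>" if "exp (- 2) \<le> a" "exp (- 2) \<le> b" for a b :: real
  proof -
    have pos: "0 < a" "0 < b" using that exp_gt_zero order.strict_trans2 by blast+
    then have "ln b - ln a \<le> (b - a) / a" by (rule ln_diff_le[rotated])
    also have "\<dots> \<le> \<bar>b - a\<bar> * (1 / a)" using pos by (simp add: divide_right_mono)
    also have "\<dots> \<le> \<bar>b - a\<bar> * exp 2"
      using that pos by (intro mult_left_mono) (auto simp: exp_minus field_simps)
    finally show ?thesis by (simp add: mult.commute)
  qed
  show ?thesis using *[of x y] *[of y x] assms by (simp add: abs_le_iff abs_minus_commute)
qed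

text \<open>
  A small second moment about \<open>y\<close> forces every eigenvalue of non-negligible weight near the point
  where \<open>exp (2 * d * u) = y\<close>; no spectral gap is involved.
\<close>

lemma second_moment_sound:
  fixes w P :: "nat \<Rightarrow> real"
  assumes w: "\<And>j. 0 \<le> w j" "0 < \<eta>" "\<eta> \<le> w 0" and N: "0 < N" and d: "d\<^sup>2 = 1" and \<sigma>: "0 < \<sigma>" "\<sigma> \<le> 1"
    and P: "\<And>i. i < 3 \<Longrightarrow> P i = (\<Sum>j<N. w j * exp (- ((E j - (\<xi> + d * i * \<sigma>)) / \<sigma>)\<^sup>2))"
    and E0: "\<bar>E 0 - \<xi>\<bar> \<le> \<sigma>" and \<epsilon>: "0 < \<epsilon>"
    and y: "exp (- 2) \<le> y" "second_moment P y \<le> 2 * (exp (- 5) * \<eta> * \<epsilon>\<^sup>2)"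
  shows "\<bar>\<xi> + d * \<sigma> * ln y / 2 - E 0\<bar> < \<epsilon>"
proof -
  define u where "u = (E 0 - \<xi>) / \<sigma>"
  define x where "x = exp (2 * d * u)"
  have d1: "\<bar>d\<bar> = 1" using d by (auto simp: power2_eq_1_iff)
  have u1: "\<bar>u\<bar> \<le> 1" using E0 \<sigma> by (simp add: u_def)
  then have "\<bar>d * u\<bar> \<le> 1" by (simp add: abs_mult d1)
  then have x: "exp (- 2) \<le> x" by (simp add: x_def abs_le_iff)
  \<comment> \<open>Only the ground state is kept from the sum of nonnegative terms; its Gaussian
    factor is at least \<open>exp (- 1)\<close>.\<close>
  have "\<eta> * exp (- 1) * (x - y)\<^sup>2 \<le> w 0 * exp (- u\<^sup>2) * (x - y)\<^sup>2"
    using u1 w by (intro mult_right_mono mult_mono) (auto simp: abs_square_le_1)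
  also have "\<dots> \<le> second_moment P y"
  proof -
    have "second_moment P y
      = (\<Sum>j<N. w j * exp (- ((E j - \<xi>) / \<sigma>)\<^sup>2) * (exp (2 * d * ((E j - \<xi>) / \<sigma>)) - y)\<^sup>2)"
      using P d \<sigma>(1) by (rule second_moment_gaussians)
    then show ?thesis
      unfolding u_def x_def by (simp only:) (rule member_le_sum[of 0], use N w in auto)
  qed
  finally have "\<eta> * exp (- 1) * (x - y)\<^sup>2 \<le> 2 * (exp (- 5) * \<eta> * \<epsilon>\<^sup>2)"
    using y by linarith
  \<comment> \<open>The constant \<open>exp (- 5)\<close> is tuned to this computation: with the
    \<open>exp 1\<close> from the Gaussian it becomes the square of \<open>exp (- 2)\<close>, which
    the Lipschitz constant \<open>exp 2\<close> of the logarithm cancels. Replacing the square root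
    of 2 by 2 makes the bound strict, and the remaining 2 is absorbed by the 2 in
    \<open>ln y / 2\<close>.\<close>
  then have "(x - y)\<^sup>2 \<le> 2 * exp (- 5) * \<epsilon>\<^sup>2 * exp 1"
    using w(2) by (simp add: exp_minus field_simps)
  also have "\<dots> = 2 * (exp (- 2) * \<epsilon>)\<^sup>2"
    by (simp add: power_mult_distrib exp_double[symmetric] mult_ac flip: exp_add)
  also have "\<dots> < (2 * (exp (- 2) * \<epsilon>))\<^sup>2"
    using \<epsilon> by (simp add: power_mult_distrib)
  finally have xy: "\<bar>x - y\<bar> < 2 * (exp (- 2) * \<epsilon>)"
    using \<epsilon> by (intro power2_less_imp_less[of "\<bar>x - y\<bar>"]) auto
  have "\<bar>ln y - ln x\<bar> \<le> exp 2 * \<bar>y - x\<bar>"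
    by (rule abs_ln_diff_le[OF x y(1)])
  also have "\<dots> < exp 2 * (2 * (exp (- 2) * \<epsilon>))"
    using xy by (simp add: abs_minus_commute)
  also have "\<dots> = 2 * \<epsilon>"
    by (simp add: exp_minus)
  finally have ln: "\<bar>ln y - ln x\<bar> < 2 * \<epsilon>" .
  have "E 0 = \<xi> + \<sigma> * u"
    using \<sigma> by (simp add: u_def)
  also have "u = d * ln x / 2"
    using d by (simp add: x_def power2_eq_square)
  finally have eq: "\<xi> + d * \<sigma> * ln y / 2 - E 0 = d * (\<sigma> * ((ln y - ln x) / 2))"
    by (simp add: algebra_simps)
  have "\<bar>\<xi> + d * \<sigma> * ln y / 2 - E 0\<bar> = \<sigma> * (\<bar>ln y - ln x\<bar> / 2)"
    unfolding eq using \<sigma> by (simp add: abs_mult d1)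
  also have "\<dots> \<le> 1 * (\<bar>ln y - ln x\<bar> / 2)"
    using \<sigma> by (intro mult_right_mono) auto
  also have "\<dots> < \<epsilon>" using ln by simp
  finally show ?thesis .
qed

text \<open>The witness \<open>y\<close> is the value belonging to the ground state, so that its own
  term vanishes. The gap pushes every other \<open>u j\<close> beyond \<open>9 * L\<close>, where
  the Gaussian outweighs the growth of the squared exponential.\<close>

lemma second_moment_complete:
  fixes w P :: "nat \<Rightarrow> real"
  assumes w: "\<And>j. 0 \<le> w j" "(\<Sum>j<N. w j) = 1" and d: "d\<^sup>2 = 1" and \<sigma>: "0 < \<sigma>"
    and P: "\<And>i. i < 3 \<Longrightarrow> P i = (\<Sum>j<N. w j * exp (- ((E j - (\<xi> + d * i * \<sigma>)) / \<sigma>)\<^sup>2))"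
    and E0: "\<bar>E 0 - \<xi>\<bar> \<le> \<sigma>" and gap: "\<And>j. 0 < j \<Longrightarrow> j < N \<Longrightarrow> 10 * L * \<sigma> \<le> E j - E 0"
    and L: "1 \<le> L" "exp (- L) \<le> \<epsilon> * \<eta>" and \<eta>: "0 < \<eta>" "\<eta> \<le> 1" and \<epsilon>: "0 < \<epsilon>"
  obtains y where "exp (- 2) \<le> y" "y \<le> exp 2" "second_moment P y \<le> exp (- 5) * \<eta> * \<epsilon>\<^sup>2 / 2"
proof
  define u where "u j = (E j - \<xi>) / \<sigma>" for j
  define y where "y = exp (2 * d * u 0)"
  have d1: "\<bar>d\<bar> = 1" using d by (auto simp: power2_eq_1_iff)
  have u0: "\<bar>u 0\<bar> \<le> 1" using E0 \<sigma> by (simp add: u_def)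
  then have du0: "\<bar>d * u 0\<bar> \<le> 1" by (simp add: abs_mult d1)
  then show y1: "exp (- 2) \<le> y" and y2: "y \<le> exp 2" by (simp_all add: y_def abs_le_iff)
  have tail: "exp (- (u j)\<^sup>2) * (exp (2 * d * u j) - y)\<^sup>2 \<le> exp (- 8 * L)" if "j < N" for j
  proof (cases "j = 0")
    case True
    then show ?thesis by (simp add: y_def)
  next
    case False
    then have "10 * L * \<sigma> \<le> E j - E 0" using gap that by simp
    then have "10 * L \<le> u j - u 0"
      using \<sigma> by (simp add: u_def pos_le_divide_eq flip: diff_divide_distrib)
    then have uj: "9 * L \<le> u j" using u0 L by linarith
    \<comment> \<open>For either sign of \<open>d\<close>, both \<open>exp (2 * d * u j)\<close> and
      \<open>y\<close> lie between 0 and \<open>exp (2 * u j)\<close>, which therefore bounds their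
      distance.\<close>
    have "d * u j \<le> u j"
      using d1 uj L abs_le_D1[of "d * u j" "u j"] by (simp add: abs_mult)
    then have "exp (2 * d * u j) \<le> exp (2 * u j)" by simp
    moreover have "y \<le> exp (2 * u j)"
      using y2 uj L by (intro order.trans[OF y2]) simp
    moreover have "0 < y" by (simp add: y_def)
    moreover have "0 < exp (2 * d * u j)" by simp
    ultimately have "\<bar>exp (2 * d * u j) - y\<bar> \<le> exp (2 * u j)" by linarith
    then have "(exp (2 * d * u j) - y)\<^sup>2 \<le> (exp (2 * u j))\<^sup>2"
      by (metis abs_ge_zero power2_abs power_mono)
    also have "\<dots> = exp (4 * u j)" by (simp flip: exp_double)
    finally have "exp (- (u j)\<^sup>2) * (exp (2 * d * u j) - y)\<^sup>2 \<le> exp (- (u j)\<^sup>2) * exp (4 * u j)"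
      by (intro mult_left_mono) auto
    also have "\<dots> = exp (- (u j * (u j - 4)))"
      by (simp add: power2_eq_square algebra_simps flip: exp_add)
    also have "\<dots> \<le> exp (- 8 * L)"
    proof -
      have "9 * L * 1 \<le> u j * (u j - 4)"
        using uj L by (intro mult_mono) auto
      then show ?thesis using L by simp
    qed
    finally show ?thesis .
  qed
  have "second_moment P y = (\<Sum>j<N. w j * (exp (- (u j)\<^sup>2) * (exp (2 * d * u j) - y)\<^sup>2))"
    using second_moment_gaussians[of P w E \<xi> d \<sigma> N y] P d \<sigma> by (simp add: u_def mult.assoc)
  also have "\<dots> \<le> (\<Sum>j<N. w j * exp (- 8 * L))"
    using tail w by (intro sum_mono mult_left_mono) auto
  also have "\<dots> = exp (- 8 * L)"
    by (simp add: w(2) flip: sum_distrib_right)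
  also have "\<dots> \<le> exp (- 5) * (exp (- L))\<^sup>2 / 2"
  proof -
    \<comment> \<open>With 2 bounded by \<open>exp 1\<close>, the exponents compare as
      \<open>1 - 8 * L \<le> - 5 - 2 * L\<close>, that is, \<open>1 \<le> L\<close>.\<close>
    have "2 * exp (- 8 * L) \<le> exp 1 * exp (- 8 * L)"
      using exp_ge_add_one_self[of 1] by (intro mult_right_mono) auto
    also have "\<dots> \<le> exp (- 5) * (exp (- L))\<^sup>2"
      using L by (simp flip: exp_add exp_double)
    finally show ?thesis by simp
  qed
  also have "\<dots> \<le> exp (- 5) * (\<epsilon> * \<eta>)\<^sup>2 / 2"
    using L by (intro divide_right_mono mult_left_mono power_mono) auto
  also have "\<dots> \<le> exp (- 5) * \<eta> * \<epsilon>\<^sup>2 / 2"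
  proof -
    have "\<eta>\<^sup>2 \<le> \<eta>"
      using \<eta> by (simp add: power2_eq_square mult_left_le)
    then have "exp (- 5) * (\<epsilon>\<^sup>2 * \<eta>\<^sup>2) \<le> exp (- 5) * (\<epsilon>\<^sup>2 * \<eta>)"
      by (intro mult_left_mono) auto
    then show ?thesis by (simp add: power_mult_distrib mult_ac)
  qed
  finally show "second_moment P y \<le> exp (- 5) * \<eta> * \<epsilon>\<^sup>2 / 2" .
qed

section \<open>The estimator\<close>

lemma output_prob_Halt: "output_prob n \<psi> B (\<lambda>_. Halt x a) P = of_bool (P x a)"
  and expected_queries_Halt: "expected_queries n \<psi> B (\<lambda>_. Halt x a) = 0"
  and valid_algorithm_Halt: "valid_algorithm n s_lo s_hi (\<lambda>_. Halt x a)"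
proof -
  have "reachable (\<lambda>_. Halt x a) h \<longleftrightarrow> h = []" for h
    by (cases h) auto
  then have "{h. reachable (\<lambda>_. Halt x a) h \<and> (\<exists>y b. Halt x a = Halt y b \<and> P y b)}
      = (if P x a then {[]} else {})"
    by auto
  then show "output_prob n \<psi> B (\<lambda>_. Halt x a) P = of_bool (P x a)"
    by (simp add: output_prob_def history_prob_def vec_norm_def)
qed (simp_all add: expected_queries_def valid_algorithm_def)

text \<open>An algorithm may be any function of the history, so a certified \<open>y\<close> can be
  taken by choice. The rejected value \<open>- 1 - \<epsilon>\<close> is farther than
  \<open>\<epsilon>\<close> from every nonnegative energy, so each rejection is a rejection of a bad
  estimate.\<close>

definition decision :: "real \<Rightarrow> real \<Rightarrow> real \<Rightarrow> real \<Rightarrow> real \<Rightarrow> (nat \<Rightarrow> real) \<Rightarrow> real \<times> bool" where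
  "decision \<xi> d \<sigma> \<epsilon> \<theta> P =
     (let ok = (\<lambda>y. exp (- 2) \<le> y \<and> y \<le> exp 2 \<and> second_moment P y \<le> \<theta>) in
      if \<exists>y. ok y then (\<xi> + d * \<sigma> * ln (SOME y. ok y) / 2, True) else (- 1 - \<epsilon>, False))"

lemma decision_accept:
  assumes "snd (decision \<xi> d \<sigma> \<epsilon> \<theta> P)"
  obtains y where "exp (- 2) \<le> y" "y \<le> exp 2" "second_moment P y \<le> \<theta>"
    "fst (decision \<xi> d \<sigma> \<epsilon> \<theta> P) = \<xi> + d * \<sigma> * ln y / 2"
proof -
  let ?ok = "\<lambda>y. exp (- 2) \<le> y \<and> y \<le> exp 2 \<and> second_moment P y \<le> \<theta>"
  have ex: "\<exists>y. ?ok y"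
    using assms by (auto simp: decision_def Let_def split: if_splits)
  show ?thesis
  proof (rule that[of "SOME y. ?ok y"])
    show "fst (decision \<xi> d \<sigma> \<epsilon> \<theta> P) = \<xi> + d * \<sigma> * ln (SOME y. ?ok y) / 2"
      unfolding decision_def Let_def if_P[OF ex] by simp
  qed (use someI_ex[OF ex] in blast)+
qed

lemma decision_reject: "\<not> snd (decision \<xi> d \<sigma> \<epsilon> \<theta> P) \<Longrightarrow> fst (decision \<xi> d \<sigma> \<epsilon> \<theta> P) = - 1 - \<epsilon>"
  by (auto simp: decision_def Let_def split: if_splits)

lemma decision_acceptI:
  "exp (- 2) \<le> y \<Longrightarrow> y \<le> exp 2 \<Longrightarrow> second_moment P y \<le> \<theta> \<Longrightarrow> snd (decision \<xi> d \<sigma> \<epsilon> \<theta> P)"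
  by (auto simp: decision_def Let_def)

text \<open>Three estimates, each failing with probability at most
  \<open>2 * exp (- (m * \<tau>\<^sup>2 / 48))\<close>, then fail with total probability at most
  \<open>\<delta> ^ 3 / 2\<close>.\<close>

definition sample_size :: "real \<Rightarrow> real \<Rightarrow> nat" where
  "sample_size \<tau> \<delta> = nat \<lceil>48 / \<tau>\<^sup>2 * ln (12 / \<delta> ^ 3)\<rceil>"

lemma sample_size_bounds:
  fixes \<tau> \<delta> :: real
  assumes "0 < \<tau>" "0 < \<delta>" "\<delta> < 1"
  shows "0 < sample_size \<tau> \<delta>"
    and "exp (- (sample_size \<tau> \<delta> * \<tau>\<^sup>2 / 48)) \<le> \<delta> ^ 3 / 12"
    and "sample_size \<tau> \<delta> \<le> 288 / \<tau>\<^sup>2 * log_trunc (1 / \<delta>) + 1"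
proof -
  have "\<delta> ^ 3 < 1" using assms by (simp add: power_less_one_iff)
  then have "1 < 12 / \<delta> ^ 3" using assms by (simp add: field_simps)
  then have ln: "0 < ln (12 / \<delta> ^ 3)" by (rule ln_gt_zero)
  then have pos: "0 < 48 / \<tau>\<^sup>2 * ln (12 / \<delta> ^ 3)" using assms by simp
  then show "0 < sample_size \<tau> \<delta>" by (simp add: sample_size_def)
  have "48 / \<tau>\<^sup>2 * ln (12 / \<delta> ^ 3) \<le> sample_size \<tau> \<delta>"
    unfolding sample_size_def by linarith
  then have "ln (12 / \<delta> ^ 3) \<le> sample_size \<tau> \<delta> * \<tau>\<^sup>2 / 48"
    using assms by (simp add: field_simps)
  then have "exp (- (sample_size \<tau> \<delta> * \<tau>\<^sup>2 / 48)) \<le> exp (- ln (12 / \<delta> ^ 3))" by simp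
  also have "\<dots> = \<delta> ^ 3 / 12" using assms by (simp add: exp_minus)
  finally show "exp (- (sample_size \<tau> \<delta> * \<tau>\<^sup>2 / 48)) \<le> \<delta> ^ 3 / 12" .
  have "ln (12 / \<delta> ^ 3) = ln 12 + 3 * ln (1 / \<delta>)"
    using assms by (simp add: ln_div ln_realpow)
  also have "\<dots> \<le> 3 * log_trunc (1 / \<delta>) + 3 * log_trunc (1 / \<delta>)"
  proof -
    \<comment> \<open>The purpose is \<open>ln 12 \<le> 3\<close>, so that the constant is absorbed
      by \<open>3 * log_trunc (1 / \<delta>)\<close>.\<close>
    have "(12 :: real) \<le> (5 / 2) ^ 3" by (simp add: power3_eq_cube)
    also have "\<dots> \<le> exp 1 ^ 3"
      using exp_lower_Taylor_quadratic[of 1] by (intro power_mono) auto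
    also have "\<dots> = exp (3 :: real)" by (simp flip: exp_of_nat_mult)
    finally have "ln 12 \<le> ln (exp (3 :: real))" by (subst ln_le_cancel_iff) auto
    then show ?thesis by (simp add: log_trunc_def)
  qed
  finally have "48 / \<tau>\<^sup>2 * ln (12 / \<delta> ^ 3) \<le> 48 / \<tau>\<^sup>2 * (6 * log_trunc (1 / \<delta>))"
    by (intro mult_left_mono) auto
  moreover have "sample_size \<tau> \<delta> \<le> 48 / \<tau>\<^sup>2 * ln (12 / \<delta> ^ 3) + 1"
    using pos unfolding sample_size_def by linarith
  ultimately show "sample_size \<tau> \<delta> \<le> 288 / \<tau>\<^sup>2 * log_trunc (1 / \<delta>) + 1" by simp
qed

text \<open>If \<open>\<sigma> < \<epsilon>\<close>, the given \<open>Ehat\<close> is already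
  accurate. If \<open>\<sigma>\<close> exceeds \<open>pi / 4\<close>, the shifts might leave the
  admissible interval, but such widths lie above the threshold, so rejection is allowed. Otherwise
  the sign \<open>d\<close> directs the shifts into the interval. The size of \<open>\<tau>\<close>
  makes the error of the second moment half of the acceptance threshold.\<close>

definition estimator :: "nat \<Rightarrow> real \<Rightarrow> real \<Rightarrow> real \<Rightarrow> real \<Rightarrow> real \<Rightarrow> algorithm" where
  "estimator n \<eta> \<epsilon> \<delta> \<sigma> Ehat =
     (if \<sigma> < \<epsilon> then \<lambda>_. Halt Ehat True
      else if pi / 4 < \<sigma> then \<lambda>_. Halt 0 False
      else
        let \<xi> = max 0 (min pi Ehat);
            d = if \<xi> \<le> pi / 2 then 1 else - 1 :: real;
            \<tau> = exp (- 9) * \<eta> * \<epsilon>\<^sup>2 / 8;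
            m = sample_size \<tau> \<delta>
        in sampling_algorithm n (\<delta>\<^sup>2) (- 1 - \<epsilon>) (\<lambda>t. \<xi> + d * real (t mod 3) * \<sigma>) \<sigma> (\<tau> / 4) (3 * m)
             (\<lambda>ks. decision \<xi> d \<sigma> \<epsilon> (exp (- 5) * \<eta> * \<epsilon>\<^sup>2) (estimate (2 ^ n) m ks)))"

text \<open>The factor \<open>ln (1 / \<delta>)\<close> comes from the probability
  \<open>1 - \<delta>\<^sup>2\<close> that sampling takes place at all; the logarithm in the sample
  size is charged to the polylogarithmic factor. The summand 1 from rounding up is absorbed because
  \<open>R * L\<close> is at least 1.\<close>

lemma query_bound:
  fixes \<eta> \<epsilon> \<delta> \<tau> \<sigma> :: real
  assumes \<eta>: "0 < \<eta>" "\<eta> < 1" and \<epsilon>: "0 < \<epsilon>" "\<epsilon> \<le> 1" and \<delta>: "0 < \<delta>" "\<delta> < 1"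
    and \<tau>: "\<tau> = exp (- 9) * \<eta> * \<epsilon>\<^sup>2 / 8"
  shows "3 * sample_size \<tau> \<delta> * (1 - \<delta>\<^sup>2) \<le> 6 * (18432 * exp 18 + 1) * (1 / \<eta> ^ 3) * (1 / \<epsilon> ^ 4) * ln (1 / \<delta>) *
    (log_trunc (1 / \<eta>) * log_trunc (1 / \<epsilon>) * log_trunc (1 / \<delta>) * log_trunc (1 / \<sigma>)) ^ 1"
proof -
  define R where "R = 1 / \<eta> ^ 3 * (1 / \<epsilon> ^ 4)"
  define L where "L = log_trunc (1 / \<delta>)"
  have log1: "1 \<le> log_trunc z" for z by (simp add: log_trunc_def)
  have \<tau>0: "0 < \<tau>" using \<eta> \<epsilon> by (simp add: \<tau>)
  have "1 \<le> 1 / \<eta> ^ 3" "1 \<le> 1 / \<epsilon> ^ 4" using \<eta> \<epsilon> by (simp_all add: power_le_one)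
  from mult_mono[OF this] have R1: "1 \<le> R"
    unfolding R_def using \<eta>(1) by (simp only: zero_le_divide_1_iff zero_le_power less_imp_le zero_le_one mult_1_left)
  have "\<eta> ^ 3 \<le> \<eta>\<^sup>2" using \<eta> by (intro power_decreasing) auto
  then have inv: "1 / \<eta>\<^sup>2 \<le> 1 / \<eta> ^ 3" using \<eta> by (intro divide_left_mono) auto
  have \<tau>2: "\<tau>\<^sup>2 = exp (- 18) * \<eta>\<^sup>2 * \<epsilon> ^ 4 / 64"
    by (simp add: \<tau> power_mult_distrib power_divide flip: exp_double power_mult)
  \<comment> \<open>Here 18432 is 288 times the square of the 8 in \<open>\<tau>\<close>.\<close>
  have "288 / \<tau>\<^sup>2 = 18432 * exp 18 * (1 / \<eta>\<^sup>2) * (1 / \<epsilon> ^ 4)"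
    unfolding \<tau>2 by (simp add: exp_minus field_simps)
  also have "\<dots> \<le> 18432 * exp 18 * (1 / \<eta> ^ 3) * (1 / \<epsilon> ^ 4)"
    using inv by (intro mult_right_mono mult_left_mono) auto
  finally have "288 / \<tau>\<^sup>2 \<le> 18432 * exp 18 * R" by (simp add: R_def)
  then have "288 / \<tau>\<^sup>2 * L \<le> 18432 * exp 18 * R * L"
    using log1 order.trans[OF zero_le_one log1] by (intro mult_right_mono) (auto simp: L_def)
  moreover have "1 \<le> R * L"
    using mult_mono[OF R1 log1[of "1 / \<delta>"]] R1 by (simp add: L_def)
  moreover have "sample_size \<tau> \<delta> \<le> 288 / \<tau>\<^sup>2 * L + 1"
    unfolding L_def by (rule sample_size_bounds(3)[OF \<tau>0 \<delta>])
  ultimately have m: "sample_size \<tau> \<delta> \<le> (18432 * exp 18 + 1) * R * L"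
    by (simp add: algebra_simps)
  have "1 - \<delta>\<^sup>2 \<le> - ln (\<delta>\<^sup>2)"
    using ln_le_minus_one[of "\<delta>\<^sup>2"] \<delta> by simp
  also have "\<dots> = 2 * ln (1 / \<delta>)"
    using \<delta> by (simp add: ln_div ln_realpow)
  finally have c: "1 - \<delta>\<^sup>2 \<le> 2 * ln (1 / \<delta>)" .
  have c0: "0 \<le> 1 - \<delta>\<^sup>2" using \<delta> by (simp add: power_le_one)
  have l0: "0 \<le> ln (1 / \<delta>)" using \<delta> by (simp add: ln_div)
  have "L \<le> (log_trunc (1 / \<eta>) * log_trunc (1 / \<epsilon>) * log_trunc (1 / \<sigma>)) * L"
  proof -
    have "1 * 1 * 1 \<le> log_trunc (1 / \<eta>) * log_trunc (1 / \<epsilon>) * log_trunc (1 / \<sigma>)"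
      using log1 order.trans[OF zero_le_one log1] by (intro mult_mono) auto
    then show ?thesis
      using log1[of "1 / \<delta>"] by (simp add: L_def)
  qed
  then have L: "L \<le> log_trunc (1 / \<eta>) * log_trunc (1 / \<epsilon>) * log_trunc (1 / \<delta>) * log_trunc (1 / \<sigma>)"
    (is "_ \<le> ?L") by (simp add: L_def mult_ac)
  have "3 * sample_size \<tau> \<delta> * (1 - \<delta>\<^sup>2) \<le> 3 * ((18432 * exp 18 + 1) * R * L) * (2 * ln (1 / \<delta>))"
    using m c c0 by (intro mult_mono) auto
  also have "\<dots> = 6 * (18432 * exp 18 + 1) * R * ln (1 / \<delta>) * L" by simp
  also have "\<dots> \<le> 6 * (18432 * exp 18 + 1) * R * ln (1 / \<delta>) * ?L"
    using R1 l0 L by (intro mult_left_mono) auto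
  finally show ?thesis by (simp add: R_def)
qed

text \<open>Here \<open>r\<close> is the weight of rejected bad estimates and \<open>b\<close> that
  of accepted ones. The early rejection gives the rejected mass the lower bound
  \<open>\<delta>\<^sup>2\<close>, so \<open>\<delta>\<close> times it dominates
  \<open>\<delta> ^ 3\<close>, hence also \<open>b\<close>.\<close>

lemma conditional_rejection_bound:
  fixes \<delta> :: real
  assumes "0 < \<delta>" "\<delta> < 1" "0 \<le> r" "0 \<le> b" "b \<le> \<delta> ^ 3 / 2"
  shows "(1 - \<delta>) * (\<delta>\<^sup>2 + (1 - \<delta>\<^sup>2) * (r + b)) \<le> \<delta>\<^sup>2 + (1 - \<delta>\<^sup>2) * r"
    and "(1 - \<delta>\<^sup>2) * b \<le> \<delta>"
proof -
  have q: "0 \<le> 1 - \<delta>\<^sup>2" "1 - \<delta>\<^sup>2 \<le> 1" using assms by (simp_all add: power_le_one)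
  have "(1 - \<delta>\<^sup>2) * b \<le> 1 * b" using q assms by (intro mult_right_mono) auto
  then have b: "(1 - \<delta>\<^sup>2) * b \<le> \<delta> ^ 3" using assms by simp
  have "(1 - \<delta>) * ((1 - \<delta>\<^sup>2) * b) \<le> 1 * \<delta> ^ 3"
    using b q assms by (intro mult_mono) auto
  also have "1 * \<delta> ^ 3 \<le> \<delta> * (\<delta>\<^sup>2 + (1 - \<delta>\<^sup>2) * r)"
    using q assms by (simp add: power3_eq_cube power2_eq_square distrib_left)
  finally show "(1 - \<delta>) * (\<delta>\<^sup>2 + (1 - \<delta>\<^sup>2) * (r + b)) \<le> \<delta>\<^sup>2 + (1 - \<delta>\<^sup>2) * r"
    by (simp add: algebra_simps)
  have "\<delta> ^ 3 \<le> \<delta> ^ 1" using assms by (intro power_decreasing) auto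
  then show "(1 - \<delta>\<^sup>2) * b \<le> \<delta>" using b by simp
qed

text \<open>After dividing by \<open>1 - \<delta>\<close>, replacing \<open>\<delta> ^ 3\<close> by
  \<open>\<delta>\<close> leaves the claim \<open>0 \<le> \<delta> * (1 - \<delta>)\<close>. Thus
  the early rejection does not spoil the success probability.\<close>

lemma acceptance_bound:
  fixes \<delta> :: real
  assumes "0 < \<delta>" "\<delta> < 1"
  shows "1 - \<delta> \<le> (1 - \<delta>\<^sup>2) * (1 - \<delta> ^ 3 / 2)"
proof -
  have cube: "\<delta> ^ 3 \<le> \<delta> ^ 1" using assms by (intro power_decreasing) auto
  have "1 * 1 \<le> (1 + \<delta>) * (1 - \<delta> ^ 3 / 2)"
  proof -
    have "(1 + \<delta>) * (1 - \<delta> / 2) \<le> (1 + \<delta>) * (1 - \<delta> ^ 3 / 2)"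
      using assms cube by (intro mult_left_mono) auto
    moreover have "0 \<le> \<delta> * (1 - \<delta>)" using assms by simp
    ultimately show ?thesis by (simp add: algebra_simps)
  qed
  then have "(1 - \<delta>) * 1 \<le> (1 - \<delta>) * ((1 + \<delta>) * (1 - \<delta> ^ 3 / 2))"
    using assms by (intro mult_left_mono) auto
  also have "\<dots> = (1 - \<delta>\<^sup>2) * (1 - \<delta> ^ 3 / 2)"
    by (simp add: power2_eq_square algebra_simps)
  finally show ?thesis by simp
qed

text \<open>The sampling regime. All probability claims follow from one set \<open>F\<close> of
  outcome lists, on which some estimate misses by \<open>\<tau>\<close>: its weight is at most
  \<open>\<delta> ^ 3 / 2\<close>, and outside it the decision is deterministically sound and, given
  the gap, accepting.\<close>

lemma estimator_correct:
  fixes n :: nat and \<eta> \<epsilon> \<delta> \<sigma> Ehat :: real and E :: "nat \<Rightarrow> real" and \<gamma> :: "nat \<Rightarrow> complex"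
  assumes \<eta>: "0 < \<eta>" "\<eta> < 1" and \<epsilon>: "0 < \<epsilon>" and \<delta>: "0 < \<delta>" "\<delta> < 1"
    and sd: "spectral_decomposition (2 ^ n) H E e"
    and E0: "0 \<le> E 0" "E 0 \<le> pi"
    and \<psi>: "\<psi> = vec (2 ^ n) (\<lambda>a. \<Sum>j<2 ^ n. \<gamma> j * (e j $ a))" "vec_norm \<psi> = 1"
    and overlap: "\<eta> \<le> (cmod (\<gamma> 0))\<^sup>2"
    and Ehat: "\<bar>Ehat - E 0\<bar> \<le> \<sigma>" and enc: "gaussian_oracle n H B"
    and \<sigma>: "\<epsilon> \<le> \<sigma>" "\<sigma> \<le> pi / 4"
  defines "A \<equiv> estimator n \<eta> \<epsilon> \<delta> \<sigma> Ehat"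
  defines "Pr \<equiv> output_prob n \<psi> B A"
  shows "valid_algorithm n \<sigma> \<sigma> A"
    and "Pr (\<lambda>x acc. True) = 1"
    and "expected_queries n \<psi> B A
      \<le> ennreal (6 * (18432 * exp 18 + 1) * (1 / \<eta> ^ 3) * (1 / \<epsilon> ^ 4) * ln (1 / \<delta>) *
          (log_trunc (1 / \<eta>) * log_trunc (1 / \<epsilon>) * log_trunc (1 / \<delta>) * log_trunc (1 / \<sigma>)) ^ 1)"
    and "ennreal (1 - \<delta>) * Pr (\<lambda>x acc. \<epsilon> \<le> \<bar>x - E 0\<bar>) \<le> Pr (\<lambda>x acc. \<epsilon> \<le> \<bar>x - E 0\<bar> \<and> \<not> acc)"
    and "Pr (\<lambda>x acc. acc \<and> \<not> \<bar>x - E 0\<bar> \<le> \<epsilon>) \<le> ennreal \<delta>"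
    and "(\<And>j. 0 < j \<Longrightarrow> j < 2 ^ n \<Longrightarrow> 10 * log_trunc (1 / (\<epsilon> * \<eta>)) * \<sigma> \<le> E j - E 0)
      \<Longrightarrow> ennreal (1 - \<delta>) \<le> Pr (\<lambda>x acc. acc \<and> \<bar>x - E 0\<bar> \<le> \<epsilon>)"
proof -
  define \<xi> where "\<xi> = max 0 (min pi Ehat)"
  define d :: real where "d = (if \<xi> \<le> pi / 2 then 1 else - 1)"
  define \<tau> where "\<tau> = exp (- 9) * \<eta> * \<epsilon>\<^sup>2 / 8"
  define m where "m = sample_size \<tau> \<delta>"
  define \<theta> where "\<theta> = exp (- 5) * \<eta> * \<epsilon>\<^sup>2"
  define shift where "shift t = \<xi> + d * real (t mod 3) * \<sigma>" for t
  define D where "D ks = decision \<xi> d \<sigma> \<epsilon> \<theta> (estimate (2 ^ n) m ks)" for ks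
  define w where "w j = (cmod (\<gamma> j))\<^sup>2" for j
  define P where "P i = (\<Sum>j<2 ^ n. w j * exp (- ((E j - (\<xi> + d * real i * \<sigma>)) / \<sigma>)\<^sup>2))" for i
  have A: "A = sampling_algorithm n (\<delta>\<^sup>2) (- 1 - \<epsilon>) shift \<sigma> (\<tau> / 4) (3 * m) D"
  proof -
    have main: "\<not> \<sigma> < \<epsilon>" "\<not> pi / 4 < \<sigma>" using \<sigma> by simp_all
    show ?thesis
      unfolding A_def estimator_def Let_def shift_def[abs_def] D_def[abs_def]
        \<theta>_def m_def \<tau>_def d_def \<xi>_def by (simp only: main if_False)
  qed

  have \<sigma>1: "0 < \<sigma>" "\<sigma> \<le> 1" "\<epsilon> \<le> 1" using \<sigma> \<epsilon> pi_less_4 by auto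
  have \<tau>: "0 < \<tau>" "\<tau> \<le> 1"
  proof -
    have "exp (- 9) * \<eta> * \<epsilon>\<^sup>2 \<le> 1 * 1 * 1"
      using \<eta> \<epsilon> \<sigma>1 by (intro mult_mono) (auto simp: power_le_one)
    then show "\<tau> \<le> 1" by (simp add: \<tau>_def)
  qed (use \<eta> \<epsilon> in \<open>simp add: \<tau>_def\<close>)
  have d2: "d\<^sup>2 = 1" by (simp add: d_def)
  have E0\<xi>: "\<bar>E 0 - \<xi>\<bar> \<le> \<sigma>" using Ehat E0 by (auto simp: \<xi>_def max_def min_def)
  \<comment> \<open>The total displacement is at most \<open>pi / 2\<close>, and \<open>d\<close>
    points from \<open>\<xi>\<close> towards the farther end of the interval.\<close>
  have shift_range: "0 \<le> shift t \<and> shift t \<le> pi" for t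
  proof -
    have "real (t mod 3) \<le> 2" using mod_less_divisor[of 3 t] by linarith
    then have "real (t mod 3) * \<sigma> \<le> 2 * (pi / 4)" using \<sigma> \<sigma>1 by (intro mult_mono) auto
    moreover have "0 \<le> real (t mod 3) * \<sigma>" using \<sigma>1 by simp
    moreover have "0 \<le> \<xi>" "\<xi> \<le> pi" by (auto simp: \<xi>_def max_def min_def)
    ultimately show ?thesis by (auto simp: shift_def d_def)
  qed
  have be: "block_encoding n (gaussian_of n H (shift t) \<sigma>) 1 1 (\<tau> / 4) (B (shift t) \<sigma> (\<tau> / 4))" for t
    using enc shift_range \<sigma>1 \<tau> by (simp add: gaussian_oracle_def)
  interpret sampling n \<psi> B "\<delta>\<^sup>2" "- 1 - \<epsilon>" \<sigma> "\<tau> / 4" shift "3 * m" D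
  proof
    show "\<psi> \<in> carrier_vec (2 ^ n)" by (simp add: \<psi>)
    show "unitary_mat (2 ^ (n + 1)) (B (shift t) \<sigma> (\<tau> / 4))" for t
      using be[of t] by (simp add: block_encoding_def)
  qed (use \<psi> \<delta> in \<open>simp_all add: power_le_one\<close>)

  have w0: "0 \<le> w j" for j by (simp add: w_def)
  have w1: "(\<Sum>j<2 ^ n. w j) = 1"
    unfolding w_def by (rule sum_weights_eq_1[OF orthonormal_if_spectral_decomposition[OF sd] \<psi>])
  have round: "\<bar>(\<Sum>k<2 ^ n. round_prob t k) - P (t mod 3)\<bar> \<le> \<tau> / 2" if "t < 3 * m" for t
  proof -
    have norm: "(vec_norm (gaussian_of n H (shift t) \<sigma> *\<^sub>v \<psi>))\<^sup>2 = P (t mod 3)"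
      unfolding power2_vec_norm_gaussian_of[OF sd \<psi>(1)] P_def shift_def w_def ..
    also have "\<dots> \<le> (\<Sum>j<2 ^ n. w j)"
      unfolding P_def by (intro sum_mono) (simp add: w0 mult_left_le)
    finally have "vec_norm (gaussian_of n H (shift t) \<sigma> *\<^sub>v \<psi>) \<le> 1"
      by (simp add: w1 power_le_one_iff vec_norm_nonneg)
    from round_prob_block_encoding[OF that be this] show ?thesis
      unfolding norm by simp
  qed

  define F where "F = (\<Union>i<3. {ks \<in> outcomes (2 ^ (n + 1)) (3 * m). \<tau> \<le> \<bar>estimate (2 ^ n) m ks i - P i\<bar>})"
  define W where "W S = (\<Sum>ks\<in>S. weight round_prob ks)" for S
  have wn: "0 \<le> weight round_prob ks" for ks
    by (rule weight_nonneg) (rule round_prob_nonneg)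
  have W_mono: "W S \<le> W S'" if "S \<subseteq> S'" "finite S'" for S S'
    unfolding W_def by (rule sum_mono2) (use that wn in auto)
  have W0: "0 \<le> W S" for S unfolding W_def by (rule sum_nonneg) (rule wn)
  have W_all: "W (outcomes (2 ^ (n + 1)) (3 * m)) = 1"
    unfolding W_def by (rule sum_weight[OF sum_round_prob]) auto
  have F: "W F \<le> \<delta> ^ 3 / 2"
  proof -
    have "W F \<le> (\<Sum>i<3. W {ks \<in> outcomes (2 ^ (n + 1)) (3 * m). \<tau> \<le> \<bar>estimate (2 ^ n) m ks i - P i\<bar>})"
      unfolding F_def W_def by (rule sum_UN_le) (auto simp: wn)
    also have "\<dots> \<le> (\<Sum>i<(3 :: nat). 2 * exp (- (m * \<tau>\<^sup>2 / 48)))"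
      unfolding W_def
      by (intro sum_mono estimate_failure)
        (use sum_round_prob round round_prob_nonneg \<tau> sample_size_bounds(1)[OF \<tau>(1) \<delta>] in \<open>auto simp: m_def\<close>)
    also have "\<dots> \<le> \<delta> ^ 3 / 2"
      using sample_size_bounds(2)[OF \<tau>(1) \<delta>] by (simp add: m_def)
    finally show ?thesis .
  qed
  have moment: "\<bar>second_moment (estimate (2 ^ n) m ks) y - second_moment P y\<bar> \<le> \<theta> / 2"
    if "ks \<in> outcomes (2 ^ (n + 1)) (3 * m)" "ks \<notin> F" "exp (- 2) \<le> y" "y \<le> exp 2" for ks y
  proof -
    have "0 \<le> y" using that(3) by (meson exp_ge_zero order.trans)
    then have "\<bar>second_moment (estimate (2 ^ n) m ks) y - second_moment P y\<bar> \<le> 4 * exp 4 * \<tau>"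
      using that by (intro second_moment_perturbation) (auto simp: F_def not_le intro: less_imp_le)
    also have "\<dots> = \<theta> / 2"
      by (simp add: \<tau>_def \<theta>_def flip: exp_add)
    finally show ?thesis .
  qed
  have sound: "\<bar>fst (D ks) - E 0\<bar> < \<epsilon>"
    if ks: "ks \<in> outcomes (2 ^ (n + 1)) (3 * m)" "ks \<notin> F" and acc: "snd (D ks)" for ks
  proof -
    obtain y where y: "exp (- 2) \<le> y" "y \<le> exp 2" "second_moment (estimate (2 ^ n) m ks) y \<le> \<theta>"
      and fst: "fst (D ks) = \<xi> + d * \<sigma> * ln y / 2"
      using acc unfolding D_def by (rule decision_accept)
    \<comment> \<open>The empirical moment is at most \<open>\<theta>\<close> and its error at most
      \<open>\<theta> / 2\<close>, within the \<open>2 * \<theta>\<close> that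
      \<open>second_moment_sound\<close> tolerates.\<close>
    have "0 \<le> \<theta>" using \<eta> by (simp add: \<theta>_def)
    then have "second_moment P y \<le> 2 * (exp (- 5) * \<eta> * \<epsilon>\<^sup>2)"
      unfolding \<theta>_def[symmetric] using moment[OF ks y(1,2)] y(3) by linarith
    then show ?thesis
      unfolding fst
      by (intro second_moment_sound[where w = w and P = P and N = "2 ^ n" and \<eta> = \<eta>])
        (use w0 \<eta> overlap d2 \<sigma>1 E0\<xi> \<epsilon> y in \<open>simp_all add: P_def w_def\<close>)
  qed
  have reject: "\<epsilon> \<le> \<bar>fst (D ks) - E 0\<bar>" if "\<not> snd (D ks)" for ks
    using decision_reject[OF that[unfolded D_def]] E0 \<epsilon> by (simp add: D_def)

  define V where "V Q = W {ks \<in> outcomes (2 ^ (n + 1)) (3 * m). Q (fst (D ks)) (snd (D ks))}"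
    for Q :: "real \<Rightarrow> bool \<Rightarrow> bool"
  have Pr: "Pr Q = ennreal (\<delta>\<^sup>2 * of_bool (Q (- 1 - \<epsilon>) False) + (1 - \<delta>\<^sup>2) * V Q)" for Q
    unfolding Pr_def A output_prob_sampling_algorithm V_def W_def ..
  have q: "0 \<le> 1 - \<delta>\<^sup>2" using \<delta> by (simp add: power_le_one)
  have far: "\<epsilon> \<le> \<bar>- 1 - \<epsilon> - E 0\<bar>" using E0 by simp

  show "valid_algorithm n \<sigma> \<sigma> A"
    unfolding A by (rule valid_sampling_algorithm) (use shift_range \<tau> in auto)
  show "Pr (\<lambda>x acc. True) = 1"
    unfolding Pr V_def using W_all by simp
  show "expected_queries n \<psi> B A
      \<le> ennreal (6 * (18432 * exp 18 + 1) * (1 / \<eta> ^ 3) * (1 / \<epsilon> ^ 4) * ln (1 / \<delta>) *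
          (log_trunc (1 / \<eta>) * log_trunc (1 / \<epsilon>) * log_trunc (1 / \<delta>) * log_trunc (1 / \<sigma>)) ^ 1)"
    unfolding A expected_queries_sampling_algorithm
    using query_bound[OF \<eta> \<epsilon> \<sigma>1(3) \<delta> \<tau>_def, of \<sigma>] by (intro ennreal_leI) (simp add: m_def)

  \<comment> \<open>By \<open>sound\<close>, an outcome list leading to an accepted bad estimate
    lies in \<open>F\<close>.\<close>
  have bad: "V (\<lambda>x acc. acc \<and> \<epsilon> \<le> \<bar>x - E 0\<bar>) \<le> \<delta> ^ 3 / 2"
    unfolding V_def
    by (rule order.trans[OF W_mono F]) (use sound in \<open>force simp: F_def not_le\<close>)+
  have split: "V (\<lambda>x acc. \<epsilon> \<le> \<bar>x - E 0\<bar>)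
      = V (\<lambda>x acc. \<epsilon> \<le> \<bar>x - E 0\<bar> \<and> \<not> acc) + V (\<lambda>x acc. acc \<and> \<epsilon> \<le> \<bar>x - E 0\<bar>)"
    unfolding V_def W_def
    by (subst sum.union_disjoint[symmetric]) (auto intro!: sum.cong)
  show "ennreal (1 - \<delta>) * Pr (\<lambda>x acc. \<epsilon> \<le> \<bar>x - E 0\<bar>) \<le> Pr (\<lambda>x acc. \<epsilon> \<le> \<bar>x - E 0\<bar> \<and> \<not> acc)"
  proof -
    have "(1 - \<delta>) * (\<delta>\<^sup>2 + (1 - \<delta>\<^sup>2) * (V (\<lambda>x acc. \<epsilon> \<le> \<bar>x - E 0\<bar> \<and> \<not> acc) + V (\<lambda>x acc. acc \<and> \<epsilon> \<le> \<bar>x - E 0\<bar>)))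
        \<le> \<delta>\<^sup>2 + (1 - \<delta>\<^sup>2) * V (\<lambda>x acc. \<epsilon> \<le> \<bar>x - E 0\<bar> \<and> \<not> acc)"
      by (rule conditional_rejection_bound(1)[OF \<delta> _ _ bad]) (simp_all add: V_def W0)
    then show ?thesis
      unfolding Pr split using far \<delta> by (simp add: ennreal_leI flip: ennreal_mult')
  qed
  show "Pr (\<lambda>x acc. acc \<and> \<not> \<bar>x - E 0\<bar> \<le> \<epsilon>) \<le> ennreal \<delta>"
  proof -
    have "V (\<lambda>x acc. acc \<and> \<not> \<bar>x - E 0\<bar> \<le> \<epsilon>) \<le> V (\<lambda>x acc. acc \<and> \<epsilon> \<le> \<bar>x - E 0\<bar>)"
      unfolding V_def by (rule W_mono) auto
    then have "V (\<lambda>x acc. acc \<and> \<not> \<bar>x - E 0\<bar> \<le> \<epsilon>) \<le> \<delta> ^ 3 / 2"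
      using bad by linarith
    then have "(1 - \<delta>\<^sup>2) * V (\<lambda>x acc. acc \<and> \<not> \<bar>x - E 0\<bar> \<le> \<epsilon>) \<le> \<delta>"
      by (intro conditional_rejection_bound(2)[OF \<delta> order.refl]) (simp_all add: V_def W0)
    then show ?thesis
      unfolding Pr by (simp add: ennreal_leI)
  qed

  assume gap: "\<And>j. 0 < j \<Longrightarrow> j < 2 ^ n \<Longrightarrow> 10 * log_trunc (1 / (\<epsilon> * \<eta>)) * \<sigma> \<le> E j - E 0"
  have "exp (- log_trunc (1 / (\<epsilon> * \<eta>))) \<le> exp (- ln (1 / (\<epsilon> * \<eta>)))"
    by (simp add: log_trunc_def)
  also have "\<dots> = \<epsilon> * \<eta>"
    using \<epsilon> \<eta> by (simp add: exp_minus)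
  finally have L: "exp (- log_trunc (1 / (\<epsilon> * \<eta>))) \<le> \<epsilon> * \<eta>" .
  obtain y where y: "exp (- 2) \<le> y" "y \<le> exp 2" "second_moment P y \<le> exp (- 5) * \<eta> * \<epsilon>\<^sup>2 / 2"
    by (rule second_moment_complete[where w = w and P = P and N = "2 ^ n" and E = E and \<xi> = \<xi> and d = d
          and \<sigma> = \<sigma> and \<eta> = \<eta> and \<epsilon> = \<epsilon> and L = "log_trunc (1 / (\<epsilon> * \<eta>))"])
      (use w0 w1 d2 \<sigma>1 E0\<xi> gap L \<eta> \<epsilon> in \<open>auto simp: P_def log_trunc_def\<close>)
  \<comment> \<open>The true moment at the witness is at most \<open>\<theta> / 2\<close>, leaving
    the other half of the threshold for sampling error. The decision may pick a different
    \<open>y\<close>, but \<open>sound\<close> covers any accepted one.\<close>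
  have accept: "snd (D ks)" if "ks \<in> outcomes (2 ^ (n + 1)) (3 * m)" "ks \<notin> F" for ks
  proof -
    have "second_moment (estimate (2 ^ n) m ks) y \<le> \<theta>"
      using moment[OF that y(1,2)] y(3) unfolding \<theta>_def by linarith
    then show ?thesis
      unfolding D_def using y by (intro decision_acceptI)
  qed
  have "F \<subseteq> outcomes (2 ^ (n + 1)) (3 * m)" by (auto simp: F_def)
  then have "1 - \<delta> ^ 3 / 2 \<le> W (outcomes (2 ^ (n + 1)) (3 * m) - F)"
    using F W_all unfolding W_def by (subst sum_diff) auto
  also have "\<dots> \<le> V (\<lambda>x acc. acc \<and> \<bar>x - E 0\<bar> \<le> \<epsilon>)"
    unfolding V_def by (rule W_mono) (use accept sound in \<open>auto intro: less_imp_le\<close>)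
  finally have "(1 - \<delta>\<^sup>2) * (1 - \<delta> ^ 3 / 2) \<le> (1 - \<delta>\<^sup>2) * V (\<lambda>x acc. acc \<and> \<bar>x - E 0\<bar> \<le> \<epsilon>)"
    using q by (intro mult_left_mono)
  then have "1 - \<delta> \<le> (1 - \<delta>\<^sup>2) * V (\<lambda>x acc. acc \<and> \<bar>x - E 0\<bar> \<le> \<epsilon>)"
    using acceptance_bound[OF \<delta>] by linarith
  then show "ennreal (1 - \<delta>) \<le> Pr (\<lambda>x acc. acc \<and> \<bar>x - E 0\<bar> \<le> \<epsilon>)"
    unfolding Pr by (simp add: ennreal_leI)
qed

section \<open>Combination of the three regimes\<close>

theorem theorem5p2:
  "\<exists>(c1::real) (c2::real) (C::real) (k::nat) (c::real)
     (alg :: nat \<Rightarrow> real \<Rightarrow> real \<Rightarrow> real \<Rightarrow> real \<Rightarrow> real \<Rightarrow> algorithm).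
     0 < c1 \<and> 0 < c2 \<and> 0 < C \<and> 0 < c \<and>
     (\<forall>(n::nat) (\<eta>::real) (\<epsilon>::real) (\<delta>::real) (H::complex mat) (E::nat \<Rightarrow> real)
        (e::nat \<Rightarrow> complex vec) (\<psi>::complex vec) (\<gamma>::nat \<Rightarrow> complex).
        1 \<le> n \<longrightarrow> 0 < \<eta> \<longrightarrow> \<eta> < 1 \<longrightarrow> 0 < \<epsilon> \<longrightarrow> 0 < \<delta> \<longrightarrow> \<delta> < 1 \<longrightarrow>
        spectral_decomposition (2 ^ n) H E e \<longrightarrow>
        0 \<le> E 0 \<longrightarrow> E 0 < E 1 \<longrightarrow>
        (\<forall>j. 1 \<le> j \<and> j + 1 < 2 ^ n \<longrightarrow> E j \<le> E (j + 1)) \<longrightarrow> E (2 ^ n - 1) \<le> pi \<longrightarrow>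
        \<psi> = vec (2 ^ n) (\<lambda>a. \<Sum>j<2 ^ n. \<gamma> j * (e j $ a)) \<longrightarrow> vec_norm \<psi> = 1 \<longrightarrow>
        \<eta> \<le> (cmod (\<gamma> 0))\<^sup>2 \<longrightarrow>
        (\<exists>\<sigma>0::real. c * ((E 1 - E 0) / log_trunc (1 / (\<epsilon> * \<eta>))) \<le> \<sigma>0 \<and>
          (\<forall>(\<sigma>::real) (Ehat::real) (B :: real \<Rightarrow> real \<Rightarrow> real \<Rightarrow> complex mat).
            0 < \<sigma> \<longrightarrow> E 0 - \<sigma> \<le> Ehat \<longrightarrow> Ehat \<le> E 0 + \<sigma> \<longrightarrow> gaussian_oracle n H B \<longrightarrow>
            (let A = alg n \<eta> \<epsilon> \<delta> \<sigma> Ehat; Pr = output_prob n \<psi> B A in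
               valid_algorithm n (c1 * \<sigma>) (c2 * \<sigma>) A \<and>
               Pr (\<lambda>x acc. True) = 1 \<and>
               expected_queries n \<psi> B A
                 \<le> ennreal (C * (1 / \<eta> ^ 3) * (1 / \<epsilon> ^ 4) * ln (1 / \<delta>) *
                     (log_trunc (1 / \<eta>) * log_trunc (1 / \<epsilon>) * log_trunc (1 / \<delta>) * log_trunc (1 / \<sigma>)) ^ k) \<and>
               Pr (\<lambda>x acc. \<epsilon> \<le> \<bar>x - E 0\<bar> \<and> \<not> acc) \<ge> ennreal (1 - \<delta>) * Pr (\<lambda>x acc. \<epsilon> \<le> \<bar>x - E 0\<bar>) \<and>
               Pr (\<lambda>x acc. acc \<and> \<not> \<bar>x - E 0\<bar> \<le> \<epsilon>) \<le> ennreal \<delta> \<and>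
               (\<sigma> \<le> \<sigma>0 \<longrightarrow> Pr (\<lambda>x acc. acc \<and> \<bar>x - E 0\<bar> \<le> \<epsilon>) \<ge> ennreal (1 - \<delta>))))))"
proof -
  have correct: "\<exists>\<sigma>0::real. 1 / 10 * ((E 1 - E 0) / log_trunc (1 / (\<epsilon> * \<eta>))) \<le> \<sigma>0 \<and>
          (\<forall>(\<sigma>::real) (Ehat::real) (B :: real \<Rightarrow> real \<Rightarrow> real \<Rightarrow> complex mat).
            0 < \<sigma> \<longrightarrow> E 0 - \<sigma> \<le> Ehat \<longrightarrow> Ehat \<le> E 0 + \<sigma> \<longrightarrow> gaussian_oracle n H B \<longrightarrow>
            (let A = estimator n \<eta> \<epsilon> \<delta> \<sigma> Ehat; Pr = output_prob n \<psi> B A in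
               valid_algorithm n (1 * \<sigma>) (1 * \<sigma>) A \<and>
               Pr (\<lambda>x acc. True) = 1 \<and>
               expected_queries n \<psi> B A
                 \<le> ennreal (6 * (18432 * exp 18 + 1) * (1 / \<eta> ^ 3) * (1 / \<epsilon> ^ 4) * ln (1 / \<delta>) *
                     (log_trunc (1 / \<eta>) * log_trunc (1 / \<epsilon>) * log_trunc (1 / \<delta>) * log_trunc (1 / \<sigma>)) ^ 1) \<and>
               Pr (\<lambda>x acc. \<epsilon> \<le> \<bar>x - E 0\<bar> \<and> \<not> acc) \<ge> ennreal (1 - \<delta>) * Pr (\<lambda>x acc. \<epsilon> \<le> \<bar>x - E 0\<bar>) \<and>
               Pr (\<lambda>x acc. acc \<and> \<not> \<bar>x - E 0\<bar> \<le> \<epsilon>) \<le> ennreal \<delta> \<and>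
               (\<sigma> \<le> \<sigma>0 \<longrightarrow> Pr (\<lambda>x acc. acc \<and> \<bar>x - E 0\<bar> \<le> \<epsilon>) \<ge> ennreal (1 - \<delta>))))"
    if n: "1 \<le> n" and \<eta>: "0 < \<eta>" "\<eta> < 1" and \<epsilon>: "0 < \<epsilon>" and \<delta>: "0 < \<delta>" "\<delta> < 1"
      and sd: "spectral_decomposition (2 ^ n) H E e"
      and E: "0 \<le> E 0" "E 0 < E 1" "\<forall>j. 1 \<le> j \<and> j + 1 < 2 ^ n \<longrightarrow> E j \<le> E (j + 1)" "E (2 ^ n - 1) \<le> pi"
      and \<psi>: "\<psi> = vec (2 ^ n) (\<lambda>a. \<Sum>j<2 ^ n. \<gamma> j * (e j $ a))" "vec_norm \<psi> = 1"
      and overlap: "\<eta> \<le> (cmod (\<gamma> 0))\<^sup>2"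
    for n :: nat and \<eta> \<epsilon> \<delta> :: real and H E e \<psi> and \<gamma> :: "nat \<Rightarrow> complex"
  proof (intro exI[of _ "1 / 10 * ((E 1 - E 0) / log_trunc (1 / (\<epsilon> * \<eta>)))"] conjI order.refl allI impI)
    fix \<sigma> Ehat :: real and B :: "real \<Rightarrow> real \<Rightarrow> real \<Rightarrow> complex mat"
    assume \<sigma>: "0 < \<sigma>" and Ehat: "E 0 - \<sigma> \<le> Ehat" "Ehat \<le> E 0 + \<sigma>" and enc: "gaussian_oracle n H B"
    let ?L = "log_trunc (1 / (\<epsilon> * \<eta>))"
    have L: "1 \<le> ?L" by (simp add: log_trunc_def)
    have mono: "j < 2 ^ n \<Longrightarrow> E 1 \<le> E j" if "1 \<le> j" for j
      using that
    proof (induction j rule: dec_induct)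
      case (step j)
      then have "E j \<le> E (j + 1)" using E(3) by simp
      then show ?case using step by simp
    qed simp
    have "(2 :: nat) ^ 1 \<le> 2 ^ n" using n by (intro power_increasing) auto
    then have "E 1 \<le> E (2 ^ n - 1)" by (intro mono) auto
    then have E1: "E 1 \<le> pi" "E 0 \<le> pi" using E by linarith+
    have gap: "10 * ?L * \<sigma> \<le> E j - E 0"
      if "\<sigma> \<le> 1 / 10 * ((E 1 - E 0) / ?L)" "0 < j" "j < 2 ^ n" for j
    proof -
      have "10 * ?L * \<sigma> \<le> E 1 - E 0" using that(1) L by (simp add: field_simps)
      then show ?thesis using mono[of j] that by simp
    qed
    \<comment> \<open>The gap is at most \<open>pi\<close>, so the threshold is at most
      \<open>pi / 10\<close>; in the wide regime the final claim is vacuous.\<close>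
    have wide: "\<not> \<sigma> \<le> 1 / 10 * ((E 1 - E 0) / ?L)" if "pi / 4 < \<sigma>"
    proof
      assume *: "\<sigma> \<le> 1 / 10 * ((E 1 - E 0) / ?L)"
      have "(E 1 - E 0) / ?L \<le> (E 1 - E 0) / 1" using L E by (intro divide_left_mono) auto
      then show False using * that E E1 by simp
    qed
    have l0: "0 \<le> ln (1 / \<delta>)" using \<delta> by (simp add: ln_div)
    have b: "0 \<le> 6 * (18432 * exp 18 + 1) * (1 / \<eta> ^ 3) * (1 / \<epsilon> ^ 4) * ln (1 / \<delta>) *
        (log_trunc (1 / \<eta>) * log_trunc (1 / \<epsilon>) * log_trunc (1 / \<delta>) * log_trunc (1 / \<sigma>)) ^ 1"
      using l0 \<eta> \<epsilon> by (intro mult_nonneg_nonneg zero_le_power) (auto simp: log_trunc_def)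
    consider "\<sigma> < \<epsilon>" | "\<epsilon> \<le> \<sigma>" "pi / 4 < \<sigma>" | "\<epsilon> \<le> \<sigma>" "\<sigma> \<le> pi / 4" by linarith
    then show "let A = estimator n \<eta> \<epsilon> \<delta> \<sigma> Ehat; Pr = output_prob n \<psi> B A in
               valid_algorithm n (1 * \<sigma>) (1 * \<sigma>) A \<and>
               Pr (\<lambda>x acc. True) = 1 \<and>
               expected_queries n \<psi> B A
                 \<le> ennreal (6 * (18432 * exp 18 + 1) * (1 / \<eta> ^ 3) * (1 / \<epsilon> ^ 4) * ln (1 / \<delta>) *
                     (log_trunc (1 / \<eta>) * log_trunc (1 / \<epsilon>) * log_trunc (1 / \<delta>) * log_trunc (1 / \<sigma>)) ^ 1) \<and>
               Pr (\<lambda>x acc. \<epsilon> \<le> \<bar>x - E 0\<bar> \<and> \<not> acc) \<ge> ennreal (1 - \<delta>) * Pr (\<lambda>x acc. \<epsilon> \<le> \<bar>x - E 0\<bar>) \<and>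
               Pr (\<lambda>x acc. acc \<and> \<not> \<bar>x - E 0\<bar> \<le> \<epsilon>) \<le> ennreal \<delta> \<and>
               (\<sigma> \<le> 1 / 10 * ((E 1 - E 0) / ?L) \<longrightarrow> Pr (\<lambda>x acc. acc \<and> \<bar>x - E 0\<bar> \<le> \<epsilon>) \<ge> ennreal (1 - \<delta>))"
    proof cases
      case 1
      then have A: "estimator n \<eta> \<epsilon> \<delta> \<sigma> Ehat = (\<lambda>_. Halt Ehat True)"
        by (simp add: estimator_def)
      have "\<bar>Ehat - E 0\<bar> < \<epsilon>" using 1 Ehat by (simp add: abs_less_iff)
      then show ?thesis
        unfolding A Let_def output_prob_Halt expected_queries_Halt
        using \<delta> by (simp add: valid_algorithm_Halt ennreal_le_1)
    next
      case 2
      then have A: "estimator n \<eta> \<epsilon> \<delta> \<sigma> Ehat = (\<lambda>_. Halt 0 False)"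
        by (simp add: estimator_def)
      \<comment> \<open>The estimate 0 is always rejected, so the bad and the rejected bad events
        coincide, whether or not 0 happens to be accurate.\<close>
      have "ennreal (1 - \<delta>) * of_bool c \<le> of_bool c" for c
        using \<delta> by (simp add: ennreal_le_1)
      then show ?thesis
        unfolding A Let_def output_prob_Halt expected_queries_Halt
        using wide[OF 2(2)] by (simp only: valid_algorithm_Halt) simp
    next
      case 3
      have "\<bar>Ehat - E 0\<bar> \<le> \<sigma>" using Ehat by (simp add: abs_le_iff)
      note main = estimator_correct[OF \<eta> \<epsilon> \<delta> sd E(1) E1(2) \<psi> overlap this enc 3]
      show ?thesis
        unfolding Let_def mult_1_left
        using main(1-5) main(6)[OF gap] by blast
    qed
  qed
  show ?thesis
    by (rule exI[of _ 1], rule exI[of _ 1], rule exI[of _ "6 * (18432 * exp 18 + 1)"],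
        rule exI[of _ 1], rule exI[of _ "1 / 10"], rule exI[of _ estimator],
        intro conjI allI impI correct) (simp_all add: add_pos_pos)
qed

end
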